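(* Let $n\ge 1$ and let $SO_o(n,1)$ be the identity component of the special orthogonal group of a real quadratic form of signature $(n,1)$. 1. Every element of $SO_o(n,1)$ is real in $SO_o(n,1)$ if and only if $n\equiv 0 \pmod 4$ or $n\equiv 3\pmod 4$. 2. If $n\equiv 1\pmod 4$, then an element $T\in SO_o(n,1)$ is real in $SO_o(n,1)$ if and only if either $T$ is a hyperbolic isometry having at least one eigenvalue $1$ or $-1$, or $T$ is not hyperbolic. 3. If $n\equiv 2\pmod 4$, then an element $T\in SO_o(n,1)$ is real in $SO_o(n,1)$ if and only if one of the following holds: (i) $T$ is hyperbolic; (ii) $T$ is non-hyperbolic and has at least one eigenvalue $-1$; (iii) $T$ is non-hyperbolic, has no eigenvalue $-1$, and there is at least one eigenvector of $T$ with eigenvalue $1$ which is space-like.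
   Context: Let $\mathbb V$ be a real vector space of dimension $n+1$ with the quadratic form $Q(x)=x_0^2+\dots+x_{n-1}^2-x_n^2$ (signature $(n,1)$). $O(n,1)$ is the group of linear isometries of $(\mathbb V,Q)$, $SO(n,1)$ its determinant-one subgroup, and $SO_o(n,1)$ the identity component. A vector $v$ is time-like, space-like, or light-like if $Q(v)<0$, $Q(v)>0$, or $Q(v)=0$ respectively. The hyperbolic space $\mathbb H^n$ is the component of $\{Q=-1\}$ containing $(0,\dots,0,1)$, and $SO_o(n,1)$ acts on it by orientation-preserving isometries; its ideal boundary is the set of light-like lines. A non-identity $T\in SO_o(n,1)$ is elliptic if it has a fixed point in $\mathbb H^n$ (equivalently fixes a time-like vector), parabolic if it has no fixed point in $\mathbb H^n$ and exactly one fixed point on the boundary (it has a unipotent block with minimal polynomial $(x-1)^3$ on a 3-dimensional time-like invariant subspace), and hyperbolic otherwise (equivalently, $T$ has a real eigenvalue $r>0$, $r\neq 1$, with light-like eigenvectors). An element $g$ of a group $G$ is real in $G$ if there is $h\in G$ with $hgh^{-1}=g^{-1}$. *)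

theory Defs
  imports "HOL-Analysis.Analysis"
begin

text \<open>The real vector space V of dimension n+1 is modelled as real^'n with CARD('n) = n+1;
  the index t :: 'n is the distinguished time-like coordinate (x_n in the paper).\<close>

definition lor_Q :: "'n::finite \<Rightarrow> real^'n \<Rightarrow> real" where
  "lor_Q t x = (\<Sum>i\<in>UNIV - {t}. (x $ i)^2) - (x $ t)^2"

definition O_n1 :: "'n::finite \<Rightarrow> (real^'n^'n) set" where
  "O_n1 t = {A. \<forall>x. lor_Q t (A *v x) = lor_Q t x}"

definition SO_n1 :: "'n::finite \<Rightarrow> (real^'n^'n) set" where
  "SO_n1 t = {A \<in> O_n1 t. det A = 1}"

definition SOo_n1 :: "'n::finite \<Rightarrow> (real^'n^'n) set" where
  "SOo_n1 t = connected_component_set (SO_n1 t) (mat 1)"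

definition time_like :: "'n::finite \<Rightarrow> real^'n \<Rightarrow> bool" where
  "time_like t v \<longleftrightarrow> lor_Q t v < 0"
definition space_like :: "'n::finite \<Rightarrow> real^'n \<Rightarrow> bool" where
  "space_like t v \<longleftrightarrow> lor_Q t v > 0"
definition light_like :: "'n::finite \<Rightarrow> real^'n \<Rightarrow> bool" where
  "light_like t v \<longleftrightarrow> lor_Q t v = 0"

definition hyp_space :: "'n::finite \<Rightarrow> (real^'n) set" where
  "hyp_space t = connected_component_set {v. lor_Q t v = -1} (axis t 1)"

definition ideal_boundary :: "'n::finite \<Rightarrow> (real^'n) set set" where
  "ideal_boundary t = {span {v} | v. v \<noteq> 0 \<and> light_like t v}"

definition elliptic :: "'n::finite \<Rightarrow> real^'n^'n \<Rightarrow> bool" where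
  "elliptic t T \<longleftrightarrow> T \<noteq> mat 1 \<and> (\<exists>p\<in>hyp_space t. T *v p = p)"

definition parabolic :: "'n::finite \<Rightarrow> real^'n^'n \<Rightarrow> bool" where
  "parabolic t T \<longleftrightarrow> T \<noteq> mat 1 \<and> \<not> (\<exists>p\<in>hyp_space t. T *v p = p)
     \<and> (\<exists>!L. L \<in> ideal_boundary t \<and> (\<lambda>x. T *v x) ` L = L)"

definition hyperbolic :: "'n::finite \<Rightarrow> real^'n^'n \<Rightarrow> bool" where
  "hyperbolic t T \<longleftrightarrow> T \<noteq> mat 1 \<and> \<not> elliptic t T \<and> \<not> parabolic t T"

definition has_eigenvalue :: "real^'n^'n \<Rightarrow> real \<Rightarrow> bool" where
  "has_eigenvalue T c \<longleftrightarrow> (\<exists>v. v \<noteq> 0 \<and> T *v v = c *\<^sub>R v)"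

definition real_in_SOo :: "'n::finite \<Rightarrow> real^'n^'n \<Rightarrow> bool" where
  "real_in_SOo t T \<longleftrightarrow> (\<exists>h\<in>SOo_n1 t. h ** T ** matrix_inv h = matrix_inv T)"

end

theory Submission
  imports Defs
begin

text \<open>By Brouwer's theorem an element T of the identity component fixes a causal ray. This splits V
  into a T-invariant time-like subspace of dimension 1 (elliptic), 2 (hyperbolic) or 3 (parabolic),
  on which 0, 1 or 1 reflection conjugates T to its inverse, and a positive definite complement.
  On the complement an eigenvector v of \<open>T + T\<^sup>-\<^sup>1\<close> spans with T v an invariant plane or line that is
  reversed by the reflection in v. So T is reversed by a product of k space-like reflections, which
  lies in the identity component iff k is even. A space-like eigenvector for the eigenvalue 1 or -1
  gives a reflection commuting with T, so the parity of k can be changed; otherwise k is determined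
  by the dimension and every isometry that reverses T and preserves the
  future cone has determinant \<open>(-1)^k\<close>.\<close>

subsection \<open>The Lorentz form\<close>

text \<open>The residues mod 4 come from counting. If T has no space-like eigenvector for 1 or -1,
  the definite complement of the axis splits into planes only, with one reflection each. Adding the
  reflection on the axis part gives 2k = n + 1 in the hyperbolic case, and 2k = n in the elliptic
  and parabolic cases. So k is odd exactly for n = 1 mod 4 and n = 2 mod 4 respectively. The
  obstacle is that a reversing element is far from unique: two of them differ by an isometry
  commuting with T, whose determinant has to be controlled. The control comes from a causal ray
  determined by T alone, which everything commuting with T must therefore preserve. The identity
  component is never described completely. Two facts suffice: its elements have determinant 1 and
  preserve the future cone, and it contains every product of two space-like reflections. The "only
  if" half of part 1 also needs explicit T without the eigenvectors above; they are assembled from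
  quarter turns, with one boost added in the hyperbolic case.\<close>

definition lor_B :: "'n::finite \<Rightarrow> real^'n \<Rightarrow> real^'n \<Rightarrow> real" where
  "lor_B t x y = x \<bullet> y - 2 * (x $ t * y $ t)"

text \<open>The Euclidean inner product serves as the reference form: positivity, orthogonal
  complements and compactness of spheres are all imported from it.\<close>

lemma lor_Q_eq: "lor_Q t x = x \<bullet> x - 2 * (x $ t)\<^sup>2"
proof -
  have "x \<bullet> x = (\<Sum>i\<in>UNIV. (x$i)\<^sup>2)"
    by (simp add: inner_vec_def power2_eq_square)
  also have "\<dots> = (x$t)\<^sup>2 + (\<Sum>i\<in>UNIV-{t}. (x$i)\<^sup>2)"
    by (rule sum.remove) auto
  finally show ?thesis by (simp add: lor_Q_def)
qed

lemma lor_B_self: "lor_B t x x = lor_Q t x"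
  by (simp add: lor_B_def lor_Q_eq power2_eq_square)

lemma lor_B_commute: "lor_B t x y = lor_B t y x"
  by (simp add: lor_B_def inner_commute)

lemma lor_B_simps [simp]:
  "lor_B t (x + y) z = lor_B t x z + lor_B t y z"
  "lor_B t z (x + y) = lor_B t z x + lor_B t z y"
  "lor_B t (x - y) z = lor_B t x z - lor_B t y z"
  "lor_B t z (x - y) = lor_B t z x - lor_B t z y"
  "lor_B t (c *\<^sub>R x) z = c * lor_B t x z"
  "lor_B t z (c *\<^sub>R x) = c * lor_B t z x"
  "lor_B t (- x) z = - lor_B t x z"
  "lor_B t z (- x) = - lor_B t z x"
  "lor_B t 0 z = 0" "lor_B t z 0 = 0"
  by (simp_all add: lor_B_def inner_simps algebra_simps)

lemma lor_Q_scale: "lor_Q t (c *\<^sub>R x) = c\<^sup>2 * lor_Q t x"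
  by (simp flip: lor_B_self add: power2_eq_square)

lemma lor_B_axis: "lor_B t x (axis t 1) = - (x $ t)"
  by (simp add: lor_B_def inner_axis)

lemma lor_Q_axis_time: "lor_Q t (axis t 1) = -1"
  by (simp add: lor_Q_eq inner_axis)

lemma lor_Q_axis_space: "i \<noteq> t \<Longrightarrow> lor_Q t (axis i 1) = 1"
  by (simp add: lor_Q_eq inner_axis) (simp add: axis_def)

lemma lor_Q_time_zero: "x $ t = 0 \<Longrightarrow> lor_Q t x = x \<bullet> x"
  by (simp add: lor_Q_eq)

section \<open>Causal vectors and what is orthogonal to them\<close>

lemma causal_time_nonzero:
  assumes "lor_Q t e \<le> 0" "e \<noteq> 0"
  shows "e $ t \<noteq> 0"
proof
  assume "e $ t = 0"
  then have "lor_Q t e = e \<bullet> e" by (rule lor_Q_time_zero)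
  with assms show False using inner_gt_zero_iff[of e] by linarith
qed

text \<open>Subtracting the right multiple of e kills the time coordinate, where the Lorentz and
  Euclidean squares agree. Since the left side is nonnegative, this identity replaces the reversed
  Cauchy-Schwarz inequality in all that follows.\<close>

lemma lor_Q_shift:
  assumes "e $ t \<noteq> 0"
  shows "(x - (x $ t / e $ t) *\<^sub>R e) \<bullet> (x - (x $ t / e $ t) *\<^sub>R e)
     = lor_Q t x - 2 * (x $ t / e $ t) * lor_B t x e + (x $ t / e $ t)\<^sup>2 * lor_Q t e"
proof -
  have "(x - (x $ t / e $ t) *\<^sub>R e) $ t = 0" using assms by simp
  then have "(x - (x $ t / e $ t) *\<^sub>R e) \<bullet> (x - (x $ t / e $ t) *\<^sub>R e)
     = lor_B t (x - (x $ t / e $ t) *\<^sub>R e) (x - (x $ t / e $ t) *\<^sub>R e)"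
    by (simp only: lor_Q_time_zero lor_B_self)
  also have "\<dots> = lor_B t x x - 2 * (x $ t / e $ t) * lor_B t x e + (x $ t / e $ t)\<^sup>2 * lor_B t e e"
    by (simp only: lor_B_simps lor_B_commute[of t e x]) (simp only: power2_eq_square algebra_simps)
  finally show ?thesis by (simp only: lor_B_self)
qed

lemma orth_time_like:
  assumes "lor_Q t p < 0" "lor_B t x p = 0" "x \<noteq> 0"
  shows "lor_Q t x > 0"
proof -
  have pt: "p $ t \<noteq> 0" using causal_time_nonzero[of t p] assms(1) by (cases "p = 0") (auto simp: lor_Q_eq)
  define s where "s = x $ t / p $ t"
  have *: "(x - s *\<^sub>R p) \<bullet> (x - s *\<^sub>R p) = lor_Q t x + s\<^sup>2 * lor_Q t p"
    using lor_Q_shift[OF pt, of x] assms(2) by (simp add: s_def)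
  show ?thesis
  proof (cases "s = 0")
    case True
    with * assms(3) show ?thesis by (metis diff_zero inner_gt_zero_iff mult_zero_left power_zero_numeral scale_zero_left add.right_neutral)
  next
    case False
    then have "s\<^sup>2 * lor_Q t p < 0" using assms(1) by (simp add: mult_pos_neg)
    with * show ?thesis using inner_ge_zero[of "x - s *\<^sub>R p"] by linarith
  qed
qed

lemma orth_light_like:
  assumes "lor_Q t e = 0" "e \<noteq> 0" "lor_B t x e = 0"
  shows "lor_Q t x \<ge> 0" "lor_Q t x = 0 \<Longrightarrow> x = (x $ t / e $ t) *\<^sub>R e"
proof -
  have et: "e $ t \<noteq> 0" using causal_time_nonzero[of t e] assms by auto
  have *: "(x - (x $ t / e $ t) *\<^sub>R e) \<bullet> (x - (x $ t / e $ t) *\<^sub>R e) = lor_Q t x"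
    using lor_Q_shift[OF et, of x] assms by simp
  show "lor_Q t x \<ge> 0" unfolding *[symmetric] by (rule inner_ge_zero)
  assume "lor_Q t x = 0"
  with * show "x = (x $ t / e $ t) *\<^sub>R e" by simp
qed

lemma orth_causal:
  assumes "lor_Q t e \<le> 0" "e \<noteq> 0" "lor_B t x e = 0" "\<And>a. x \<noteq> a *\<^sub>R e"
  shows "lor_Q t x > 0"
proof (cases "lor_Q t e = 0")
  case True
  then show ?thesis using orth_light_like[OF True assms(2,3)] assms(4) by (metis order_le_less)
next
  case False
  have "x \<noteq> 0" using assms(4)[of 0] by simp
  then show ?thesis using orth_time_like[of t e x] False assms by simp
qed

text \<open>This is what makes the sign of \<open>lor_B\<close> detect time orientation. One vector
  may be light-like, but the strict inequality for y excludes two parallel light-like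
  vectors.\<close>

lemma future_B_neg:
  assumes "lor_Q t x \<le> 0" "x $ t > 0" "lor_Q t y < 0" "y $ t > 0"
  shows "lor_B t x y < 0"
proof -
  define s where "s = x $ t / y $ t"
  have s: "s > 0" using assms by (simp add: s_def)
  have "0 \<le> lor_Q t x - 2 * s * lor_B t x y + s\<^sup>2 * lor_Q t y"
    using lor_Q_shift[of y t x] assms(4) inner_ge_zero[of "x - s *\<^sub>R y"] by (simp add: s_def)
  moreover have "s\<^sup>2 * lor_Q t y < 0" using s assms(3) by (simp add: mult_pos_neg)
  ultimately have "s * lor_B t x y < 0" using assms(1) by linarith
  then show ?thesis using s by (simp add: mult_less_0_iff)
qed

subsection \<open>Isometries and their determinants\<close>

lemma O_B:
  assumes "A \<in> O_n1 t"
  shows "lor_B t (A *v x) (A *v y) = lor_B t x y"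
proof -
  have Q: "lor_Q t (A *v x) = lor_Q t x" for x using assms by (simp add: O_n1_def)
  have pol: "2 * lor_B t x y = lor_Q t (x + y) - lor_Q t x - lor_Q t y" for x y
    by (simp flip: lor_B_self add: lor_B_commute[of t y x])
  have "2 * lor_B t (A *v x) (A *v y) = 2 * lor_B t x y"
    unfolding pol by (simp flip: matrix_vector_right_distrib add: Q)
  then show ?thesis by simp
qed

lemma O_Q: "A \<in> O_n1 t \<Longrightarrow> lor_Q t (A *v x) = lor_Q t x"
  by (simp add: O_n1_def)

lemma O_I: "(\<And>x. lor_Q t (A *v x) = lor_Q t x) \<Longrightarrow> A \<in> O_n1 t"
  by (simp add: O_n1_def)

lemma O_one: "mat 1 \<in> O_n1 t"
  by (simp add: O_n1_def)

lemma O_mult: "A \<in> O_n1 t \<Longrightarrow> C \<in> O_n1 t \<Longrightarrow> A ** C \<in> O_n1 t"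
  by (simp add: O_n1_def flip: matrix_vector_mul_assoc)

text \<open>The Gram matrix of the form. It turns Lorentz adjoints into transposes, so that
  determinants of adjoints can be compared.\<close>

definition lor_J :: "'n::finite \<Rightarrow> real^'n^'n" where
  "lor_J t = (\<chi> i j. if i = j then (if i = t then -1 else 1) else 0)"

lemma lor_J_mult: "lor_J t *v x = x - (2 * x $ t) *\<^sub>R axis t 1"
proof -
  have "(lor_J t *v x) $ i = (x - (2 * x $ t) *\<^sub>R axis t 1) $ i" for i
  proof -
    have "(lor_J t *v x) $ i = (\<Sum>j\<in>UNIV. lor_J t $ i $ j * x $ j)"
      by (simp add: matrix_vector_mult_def)
    also have "\<dots> = (\<Sum>j\<in>UNIV. if i = j then (if i = t then - (x$j) else x$j) else 0)"
      by (rule sum.cong) (auto simp: lor_J_def)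
    also have "\<dots> = (if i = t then - (x$i) else x$i)" by simp
    also have "\<dots> = (x - (2 * x $ t) *\<^sub>R axis t 1) $ i" by (simp add: axis_def)
    finally show ?thesis .
  qed
  then show ?thesis by (simp add: vec_eq_iff)
qed

lemma lor_B_J: "lor_B t x y = x \<bullet> (lor_J t *v y)"
  by (simp add: lor_J_mult lor_B_def inner_simps inner_axis)

lemma det_lor_J: "det (lor_J t) \<noteq> 0"
proof -
  have "det (lor_J t) = prod (\<lambda>i. lor_J t $ i $ i) UNIV"
    by (rule det_diagonal) (simp add: lor_J_def)
  then show ?thesis by (simp add: lor_J_def)
qed

lemma matrix_eq_inner:
  fixes A C :: "real^'n^'n"
  assumes "\<And>x y. x \<bullet> (A *v y) = x \<bullet> (C *v y)"
  shows "A = C"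
  using assms by (metis matrix_eq vector_eq_ldot)

lemma O_J: 
  assumes "A \<in> O_n1 t"
  shows "transpose A ** lor_J t ** A = lor_J t"
proof (rule matrix_eq_inner)
  fix x y
  have "x \<bullet> ((transpose A ** lor_J t ** A) *v y) = (A *v x) \<bullet> (lor_J t *v (A *v y))"
    by (metis (no_types) dot_lmul_matrix matrix_vector_mul_assoc inner_commute vector_transpose_matrix transpose_matrix_vector)
  then show "x \<bullet> ((transpose A ** lor_J t ** A) *v y) = x \<bullet> (lor_J t *v y)"
    using O_B[OF assms] by (simp flip: lor_B_J)
qed

lemma O_det_sq: 
  assumes "A \<in> O_n1 t"
  shows "det A = 1 \<or> det A = -1"
proof -
  have "det A * det (lor_J t) * det A = det (lor_J t)"
    using arg_cong[OF O_J[OF assms], of det] by (simp add: det_mul det_transpose)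
  then have "(det A)\<^sup>2 = 1" using det_lor_J[of t] by (simp add: power2_eq_square)
  then show ?thesis by (simp add: power2_eq_1_iff)
qed

lemma O_invertible: "A \<in> O_n1 t \<Longrightarrow> invertible A"
  using O_det_sq[of A t] by (auto simp: invertible_det_nz)

lemma matrix_inv_cancel:
  fixes A :: "real^'n^'n"
  assumes "invertible A"
  shows "A ** matrix_inv A = mat 1" "matrix_inv A ** A = mat 1"
proof -
  have "\<exists>A'. A ** A' = mat 1 \<and> A' ** A = mat 1" using assms by (simp add: invertible_def)
  from someI_ex[OF this] show "A ** matrix_inv A = mat 1" "matrix_inv A ** A = mat 1"
    by (simp_all add: matrix_inv_def)
qed

lemma O_inj: "A \<in> O_n1 t \<Longrightarrow> A *v x = A *v y \<Longrightarrow> x = y"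
  by (metis O_invertible matrix_inv_cancel(2) matrix_vector_mul_assoc matrix_vector_mul_lid)

text \<open>The key identity is \<open>A\<^sup>* (A + 1) = (1 + A)\<^sup>*\<close>, where \<open>A\<^sup>* = A\<^sup>-\<^sup>1\<close> is the adjoint of A.\<close>

lemma O_det_1:
  assumes "A \<in> O_n1 t" "\<And>x. A *v x = - x \<Longrightarrow> x = 0"
  shows "det A = 1"
proof -
  have "det (A + mat 1) \<noteq> 0"
  proof -
    have "inj ((*v) (A + mat 1))"
      unfolding linear_injective_0[OF matrix_vector_mul_linear]
      using assms(2) by (simp add: matrix_vector_mult_add_rdistrib add_eq_0_iff2)
    then show ?thesis
      using det_nz_iff_inj[of "(*v) (A + mat 1)"] by simp
  qed
  moreover have "transpose A ** lor_J t ** (A + mat 1) = transpose (A + mat 1) ** lor_J t"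
  proof -
    have "transpose (A + mat 1) = transpose A + mat 1" by (simp add: transpose_def vec_eq_iff mat_def)
    then have "transpose (A + mat 1) ** lor_J t = transpose A ** lor_J t + lor_J t"
      by (simp add: matrix_eq matrix_vector_mult_add_rdistrib flip: matrix_vector_mul_assoc)
    then show ?thesis by (simp add: matrix_add_ldistrib O_J[OF assms(1)])
  qed
  from arg_cong[OF this, of det] have "det A * det (A + mat 1) = det (A + mat 1)"
    using det_lor_J[of t] by (simp add: det_mul)
  ultimately show ?thesis by simp
qed

subsection \<open>The identity component\<close>

lemma continuous_on_det: "continuous_on S (det :: real^'n^'n \<Rightarrow> real)"
  unfolding det_def by (intro continuous_intros)

lemma continuous_on_matrix_mult_left: "continuous_on S (\<lambda>X::real^'n^'n. A ** X)"
  unfolding matrix_matrix_mult_def by (intro continuous_intros)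

lemma connected_O_det:
  assumes "connected C" "C \<subseteq> O_n1 t" "A \<in> C" "A' \<in> C"
  shows "det A = det A'"
proof -
  have "det ` C \<subseteq> {1, -1}" using assms(2) O_det_sq by blast
  then have "finite (det ` C)" by (rule finite_subset) simp
  then have "det constant_on C"
    by (rule continuous_finite_range_constant[OF assms(1) continuous_on_det])
  then show ?thesis using assms(3,4) by (auto simp: constant_on_def)
qed

text \<open>The determinant has finitely many values on isometries, hence is constant on C and equal
  to its value at the identity.\<close>

lemma connected_SOo:
  assumes "connected C" "C \<subseteq> O_n1 t" "mat 1 \<in> C"
  shows "C \<subseteq> SOo_n1 t"
  unfolding SOo_n1_def
proof (rule connected_component_maximal)
  show "C \<subseteq> SO_n1 t"
  proof
    fix A assume "A \<in> C"
    then show "A \<in> SO_n1 t"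
      using connected_O_det[OF assms(1,2) _ assms(3), of A] assms(2) by (auto simp: SO_n1_def)
  qed
qed (use assms in auto)

lemma SOo_SO: "A \<in> SOo_n1 t \<Longrightarrow> A \<in> SO_n1 t"
  unfolding SOo_n1_def using connected_component_subset by blast

lemma SOo_O: "A \<in> SOo_n1 t \<Longrightarrow> A \<in> O_n1 t"
  using SOo_SO by (auto simp: SO_n1_def)

lemma SOo_det: "A \<in> SOo_n1 t \<Longrightarrow> det A = 1"
  using SOo_SO by (auto simp: SO_n1_def)

lemma SOo_one: "mat 1 \<in> SOo_n1 t"
  using connected_SOo[of "{mat 1}" t] by (simp add: O_one)

text \<open>Left translation by A carries the component of the identity to a connected set that
  joins A to \<open>A ** C\<close>.\<close>

lemma SOo_mult:
  assumes "A \<in> SOo_n1 t" "C \<in> SOo_n1 t"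
  shows "A ** C \<in> SOo_n1 t"
proof -
  let ?S = "SO_n1 t"
  have sub: "(\<lambda>X. A ** X) ` SOo_n1 t \<subseteq> ?S"
    using SOo_SO[OF assms(1)] SOo_SO[of _ t] by (fastforce simp: SO_n1_def det_mul intro: O_mult)
  have "connected ((\<lambda>X. A ** X) ` SOo_n1 t)"
    by (rule connected_continuous_image[OF continuous_on_matrix_mult_left])
      (simp add: SOo_n1_def)
  moreover have "A \<in> (\<lambda>X. A ** X) ` SOo_n1 t"
    using SOo_one[of t] by (rule rev_image_eqI) simp
  moreover have "A ** C \<in> (\<lambda>X. A ** X) ` SOo_n1 t" using assms(2) by blast
  ultimately have "connected_component ?S A (A ** C)"
    using sub unfolding connected_component_def by blast
  moreover have "connected_component ?S (mat 1) A"
    using assms(1) by (simp add: SOo_n1_def)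
  ultimately show ?thesis
    unfolding SOo_n1_def mem_Collect_eq by (rule connected_component_trans[rotated])
qed

text \<open>Asking this of every future causal vector, not only of the time axis, makes the property
  closed under composition of isometries.\<close>

definition orthochronous :: "'n::finite \<Rightarrow> real^'n^'n \<Rightarrow> bool" where
  "orthochronous t A \<longleftrightarrow> (\<forall>x. lor_Q t x \<le> 0 \<longrightarrow> x $ t > 0 \<longrightarrow> (A *v x) $ t > 0)"

lemma orthochronous_mult:
  assumes "orthochronous t A" "orthochronous t C" "C \<in> O_n1 t"
  shows "orthochronous t (A ** C)"
  using assms by (simp add: orthochronous_def O_Q flip: matrix_vector_mul_assoc)

text \<open>With y the preimage of the time axis, the time coordinate of A x is minus the product of
  x and y. The same formula shows that y is itself a future vector, so \<open>future_B_neg\<close>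
  decides the sign.\<close>

lemma orthochronousI:
  assumes "A \<in> O_n1 t" "(A *v axis t 1) $ t > 0"
  shows "orthochronous t A"
  unfolding orthochronous_def
proof (intro allI impI)
  fix x assume x: "lor_Q t x \<le> 0" "x $ t > 0"
  define y where "y = matrix_inv A *v axis t 1"
  have y: "A *v y = axis t 1"
    by (simp add: y_def matrix_vector_mul_assoc matrix_inv_cancel O_invertible[OF assms(1)])
  have "y $ t = - lor_B t y (axis t 1)" by (simp add: lor_B_axis)
  also have "\<dots> = - lor_B t (axis t 1) (A *v axis t 1)"
    using O_B[OF assms(1), of y "axis t 1"] by (simp add: y)
  finally have "y $ t > 0" using assms(2) by (simp add: lor_B_commute[of t "axis t 1"] lor_B_axis)
  moreover have "lor_Q t y = -1" using O_Q[OF assms(1), of y] by (simp add: y lor_Q_axis_time)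
  ultimately have "lor_B t x y < 0" using future_B_neg[OF x] by simp
  moreover have "(A *v x) $ t = - lor_B t x y"
    using O_B[OF assms(1), of x y] by (simp add: y lor_B_axis)
  ultimately show "(A *v x) $ t > 0" by simp
qed

text \<open>The image of the time axis stays time-like, so its time coordinate never vanishes and
  cannot change sign on a connected set.\<close>

lemma SOo_orthochronous:
  assumes "A \<in> SOo_n1 t"
  shows "orthochronous t A"
proof (rule orthochronousI)
  show A: "A \<in> O_n1 t" using assms by (rule SOo_O)
  let ?f = "\<lambda>X. (X *v axis t 1) $ t :: real"
  have c: "connected (?f ` SOo_n1 t)"
  proof (rule connected_continuous_image)
    show "continuous_on (SOo_n1 t) ?f"
      unfolding matrix_vector_mult_def by (intro continuous_intros)
  qed (simp add: SOo_n1_def)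
  have nz: "?f X \<noteq> 0" if "X \<in> SOo_n1 t" for X
    using O_Q[OF SOo_O[OF that], of "axis t 1"] 
      by (intro causal_time_nonzero) (auto simp: lor_Q_axis_time lor_Q_eq)
  show "?f A > 0"
  proof (rule ccontr)
    assume "\<not> ?f A > 0"
    moreover have "?f (mat 1) = 1" by simp
    ultimately have "0 \<in> ?f ` SOo_n1 t"
      using connectedD_interval[OF c imageI[OF assms] imageI[OF SOo_one], of 0] by simp
    then show False using nz by force
  qed
qed

subsection \<open>Reflections\<close>

definition lor_refl :: "'n::finite \<Rightarrow> real^'n \<Rightarrow> real^'n^'n" where
  "lor_refl t u = (\<chi> i j. (if i = j then 1 else 0) - 2 * u $ i * (lor_J t *v u) $ j / lor_Q t u)"

lemma lor_refl_mult: "lor_refl t u *v x = x - (2 * lor_B t x u / lor_Q t u) *\<^sub>R u"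
proof -
  have "(lor_refl t u *v x) $ i = (x - (2 * lor_B t x u / lor_Q t u) *\<^sub>R u) $ i" for i
  proof -
    have "(lor_refl t u *v x) $ i = (\<Sum>j\<in>UNIV. lor_refl t u $ i $ j * x $ j)"
      by (simp add: matrix_vector_mult_def)
    also have "\<dots> = (\<Sum>j\<in>UNIV. (if i = j then x $ j else 0) - (2 * u $ i / lor_Q t u) * (x $ j * (lor_J t *v u) $ j))"
      by (rule sum.cong) (auto simp: lor_refl_def algebra_simps)
    also have "\<dots> = x $ i - (2 * u $ i / lor_Q t u) * lor_B t x u"
      by (simp add: sum_subtractf lor_B_J inner_vec_def del: times_divide_eq_left flip: sum_distrib_left)
    finally show ?thesis by simp
  qed
  then show ?thesis by (simp add: vec_eq_iff)
qed

lemma lor_refl_self: "lor_Q t u \<noteq> 0 \<Longrightarrow> lor_refl t u *v u = - u"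
  by (simp add: lor_refl_mult lor_B_self scaleR_2)

lemma lor_refl_orth: "lor_B t x u = 0 \<Longrightarrow> lor_refl t u *v x = x"
  by (simp add: lor_refl_mult)

lemma lor_refl_O:
  assumes "lor_Q t u \<noteq> 0" 
  shows "lor_refl t u \<in> O_n1 t"
proof (rule O_I)
  fix x
  define c where "c = 2 * lor_B t x u / lor_Q t u"
  have "lor_refl t u *v x = x - c *\<^sub>R u" by (simp add: lor_refl_mult c_def)
  then have "lor_Q t (lor_refl t u *v x) = lor_B t x x - 2 * c * lor_B t x u + c * (c * lor_B t u u)"
    by (simp add: lor_B_commute[of t u x] right_diff_distrib flip: lor_B_self)
  moreover have "c * lor_B t u u = 2 * lor_B t x u" using assms by (simp add: c_def lor_B_self)
  ultimately show "lor_Q t (lor_refl t u *v x) = lor_Q t x" by (simp only: lor_B_self)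
qed

lemma lor_refl_invol:
  assumes "lor_Q t u \<noteq> 0" 
  shows "lor_refl t u ** lor_refl t u = mat 1"
proof -
  have "lor_refl t u *v (lor_refl t u *v x) = x" for x
    using assms by (simp add: lor_refl_mult[of t u x] algebra_simps lor_refl_self)
  then show ?thesis by (simp add: matrix_eq flip: matrix_vector_mul_assoc)
qed

lemma lor_refl_minus: "lor_refl t (- u) = lor_refl t u"
  by (simp add: matrix_eq lor_refl_mult lor_Q_eq)

lemma continuous_on_lor_refl: "continuous_on {u. lor_Q t u > 0} (lor_refl t)"
  unfolding lor_refl_def lor_Q_eq matrix_vector_mult_def
  by (intro continuous_intros) auto

text \<open>Moving u along the segment to w deforms the product to the square of one reflection, the
  identity. The segment stays space-like when \<open>lor_B t u w\<close> is nonnegative; otherwise w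
  is replaced by its negative, which has the same reflection.\<close>

lemma lor_refl_pair_SOo:
  assumes "lor_Q t u > 0" "lor_Q t w > 0"
  shows "lor_refl t u ** lor_refl t w \<in> SOo_n1 t"
proof -
  have *: "lor_refl t u ** lor_refl t w \<in> SOo_n1 t"
    if w: "lor_Q t w > 0" and uw: "lor_B t u w \<ge> 0" for w
  proof -
    let ?g = "\<lambda>s::real. (1 - s) *\<^sub>R u + s *\<^sub>R w"
    let ?C = "(\<lambda>X. X ** lor_refl t w) ` lor_refl t ` ?g ` {0..1}"
    have sp: "lor_Q t (?g s) > 0" if s: "s \<in> {0..1}" for s
    proof -
      have "lor_Q t (?g s) = (1 - s)\<^sup>2 * lor_Q t u + s\<^sup>2 * lor_Q t w + 2 * (1 - s) * s * lor_B t u w"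
        by (simp add: lor_B_commute[of t w u] power2_eq_square algebra_simps flip: lor_B_self)
      moreover have "(1 - s) * s * lor_B t u w \<ge> 0" using s uw by simp
      moreover have "(1 - s)\<^sup>2 * lor_Q t u + s\<^sup>2 * lor_Q t w > 0"
        using assms(1) w by (cases "s = 0") (auto intro!: add_nonneg_pos)
      ultimately show ?thesis by linarith
    qed
    have "connected (?g ` {0..1})"
      by (intro connected_continuous_image continuous_intros) simp
    then have "connected (lor_refl t ` ?g ` {0..1})"
      by (rule connected_continuous_image[rotated])
        (rule continuous_on_subset[OF continuous_on_lor_refl], use sp in blast)
    then have "connected ?C"
      by (rule connected_continuous_image[rotated])
         (unfold matrix_matrix_mult_def, intro continuous_intros)
    moreover have "?C \<subseteq> O_n1 t"
    proof -
      have "lor_refl t (?g s) ** lor_refl t w \<in> O_n1 t" if "s \<in> {0..1}" for s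
        using sp[OF that] w by (intro O_mult lor_refl_O) auto
      then show ?thesis by blast
    qed
    moreover have "lor_refl t (?g 1) ** lor_refl t w \<in> ?C"
      by (intro imageI) simp
    then have "mat 1 \<in> ?C" using w by (simp add: lor_refl_invol)
    ultimately have "?C \<subseteq> SOo_n1 t" by (rule connected_SOo)
    moreover have "lor_refl t (?g 0) ** lor_refl t w \<in> ?C"
      by (intro imageI) simp
    ultimately show ?thesis by auto
  qed
  show ?thesis
  proof (cases "lor_B t u w \<ge> 0")
    case True
    then show ?thesis using * assms by blast
  next
    case False
    then show ?thesis using *[of "- w"] assms lor_Q_scale[of t "-1" w] by (simp add: lor_refl_minus)
  qed
qed

text \<open>Only the reflection in a coordinate axis is computed, where the matrix is diagonal; the
  general case follows because the product of two space-like reflections has determinant 1.\<close>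

lemma det_lor_refl:
  assumes "lor_Q t u > 0"
  shows "det (lor_refl t u) = -1"
proof -
  \<comment> \<open>A space-like u cannot exist when the time axis is the only coordinate.\<close>
  have "\<exists>i. i \<noteq> t"
  proof (rule ccontr)
    assume "\<nexists>i. i \<noteq> t"
    then have "(\<Sum>i\<in>UNIV - {t}. (u $ i)\<^sup>2) = 0" by (intro sum.neutral) auto
    then have "lor_Q t u = - (u $ t)\<^sup>2" unfolding lor_Q_def by simp
    then show False using assms by (simp add: not_less)
  qed
  then obtain i where i: "i \<noteq> t" ..
  have ii: "lor_Q t (axis i 1) = 1" using i by (rule lor_Q_axis_space)
  have "lor_J t *v axis i 1 = axis i 1" using i by (simp add: lor_J_mult) (simp add: axis_def)
  then have e: "lor_refl t (axis i 1) = (\<chi> j k. if j = k then (if j = i then -1 else 1) else 0)"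
    using ii by (auto simp: lor_refl_def vec_eq_iff axis_def)
  have "det (lor_refl t (axis i 1)) = prod (\<lambda>j. lor_refl t (axis i 1) $ j $ j) UNIV"
    by (rule det_diagonal) (simp add: e)
  also have "\<dots> = (\<Prod>j\<in>UNIV. if j = i then -1 else 1)" by (simp add: e)
  also have "\<dots> = -1" by simp
  finally have "det (lor_refl t (axis i 1)) = -1" .
  moreover have "det (lor_refl t u ** lor_refl t (axis i 1)) = 1"
    using lor_refl_pair_SOo[of t u "axis i 1"] assms ii by (intro SOo_det) auto
  ultimately show ?thesis by (simp add: det_mul)
qed

lemma lor_refl_orthochronous:
  assumes "lor_Q t u > 0"
  shows "orthochronous t (lor_refl t u)"
proof (rule orthochronousI)
  show "lor_refl t u \<in> O_n1 t" using assms by (intro lor_refl_O) auto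
  have "lor_B t (axis t 1) u = - (u $ t)" by (metis lor_B_axis lor_B_commute)
  then have "(lor_refl t u *v axis t 1) $ t = 1 + 2 * (u $ t)\<^sup>2 / lor_Q t u"
    by (simp add: lor_refl_mult power2_eq_square)
  moreover have "(u $ t)\<^sup>2 / lor_Q t u \<ge> 0" using assms by simp
  ultimately show "(lor_refl t u *v axis t 1) $ t > 0" by simp
qed

primrec refl_prod :: "'n::finite \<Rightarrow> (real^'n) list \<Rightarrow> real^'n^'n" where
  "refl_prod t [] = mat 1"
| "refl_prod t (u # us) = lor_refl t u ** refl_prod t us"

lemma refl_prod_append: "refl_prod t (us @ ws) = refl_prod t us ** refl_prod t ws"
  by (induction us) (simp_all add: matrix_mul_assoc)

lemma refl_prod_O: "\<forall>u\<in>set us. lor_Q t u > 0 \<Longrightarrow> refl_prod t us \<in> O_n1 t"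
  by (induction us) (auto simp: O_one intro!: O_mult lor_refl_O)

lemma refl_prod_orthochronous: "\<forall>u\<in>set us. lor_Q t u > 0 \<Longrightarrow> orthochronous t (refl_prod t us)"
proof (induction us)
  case Nil
  then show ?case by (simp add: orthochronous_def)
next
  case (Cons u us)
  then show ?case by (auto intro!: orthochronous_mult lor_refl_orthochronous refl_prod_O)
qed

lemma det_refl_prod: "\<forall>u\<in>set us. lor_Q t u > 0 \<Longrightarrow> det (refl_prod t us) = (-1) ^ length us"
  by (induction us) (auto simp: det_mul det_lor_refl)

lemma refl_prod_SOo: "\<forall>u\<in>set us. lor_Q t u > 0 \<Longrightarrow> even (length us) \<Longrightarrow> refl_prod t us \<in> SOo_n1 t"
proof (induction us rule: induct_list012)
  case (3 u w us)
  then have "(lor_refl t u ** lor_refl t w) ** refl_prod t us \<in> SOo_n1 t"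
    by (intro SOo_mult lor_refl_pair_SOo) auto
  then show ?case by (simp add: matrix_mul_assoc)
qed (auto simp: SOo_one)

lemma refl_prod_orth:
  assumes "\<forall>u\<in>set us. lor_B t x u = 0"
  shows "refl_prod t us *v x = x"
  using assms by (induction us) (auto simp: lor_refl_orth simp flip: matrix_vector_mul_assoc)

lemma refl_prod_in:
  assumes "subspace W" "set us \<subseteq> W" "x \<in> W"
  shows "refl_prod t us *v x \<in> W"
  using assms(2)
proof (induction us)
  case (Cons u us)
  then have "lor_refl t u *v (refl_prod t us *v x) \<in> W"
    unfolding lor_refl_mult using assms(1) by (intro subspace_diff subspace_scale) auto
  then show ?case by (simp add: matrix_vector_mul_assoc)
qed (use assms in simp)

subsection \<open>Orthogonal decompositions\<close>

definition lor_orth :: "'n::finite \<Rightarrow> (real^'n) set \<Rightarrow> (real^'n) set" where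
  "lor_orth t P = {x. \<forall>y\<in>P. lor_B t x y = 0}"

text \<open>The radical of the form restricted to P is trivial. Unlike in Euclidean space this can
  fail, for instance on a light-like line.\<close>

definition nondegenerate :: "'n::finite \<Rightarrow> (real^'n) set \<Rightarrow> bool" where
  "nondegenerate t P \<longleftrightarrow> P \<inter> lor_orth t P \<subseteq> {0}"

definition pos_def :: "'n::finite \<Rightarrow> (real^'n) set \<Rightarrow> bool" where
  "pos_def t P \<longleftrightarrow> (\<forall>x\<in>P. x \<noteq> 0 \<longrightarrow> lor_Q t x > 0)"

lemma pos_def_nondegenerate: "pos_def t P \<Longrightarrow> nondegenerate t P"
  unfolding pos_def_def nondegenerate_def lor_orth_def
  by (force simp flip: lor_B_self)

lemma time_like_nondegenerate:
  assumes "p \<in> P" "lor_Q t p < 0"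
  shows "nondegenerate t P"
  unfolding nondegenerate_def
proof
  fix x assume x: "x \<in> P \<inter> lor_orth t P"
  then have "lor_B t x p = 0" "lor_Q t x = 0"
    using assms(1) by (auto simp: lor_orth_def simp flip: lor_B_self)
  then show "x \<in> {0}" using orth_time_like[OF assms(2), of x] by auto
qed

lemma time_like_orth_pos_def:
  assumes "p \<in> P" "lor_Q t p < 0"
  shows "pos_def t (lor_orth t P)"
  unfolding pos_def_def lor_orth_def using orth_time_like[OF assms(2)] assms(1) by blast

lemma pos_def_subset: "pos_def t W \<Longrightarrow> P \<subseteq> W \<Longrightarrow> pos_def t P"
  by (auto simp: pos_def_def)

lemma subspace_lor_orth: "subspace (lor_orth t P)"
  unfolding subspace_def lor_orth_def by simp

lemma dim_lor_orth:
  fixes P :: "(real^'n) set"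
  assumes "subspace P"
  shows "dim (lor_orth t P) + dim P = CARD('n)"
proof -
  let ?J = "(*v) (lor_J t)"
  have JJ: "?J (?J x) = x" for x :: "real^'n"
    by (simp add: lor_J_mult flip: scaleR_add_left)
  then have "inj_on ?J (span P)" by (metis inj_onI)
  then have d: "dim (?J ` P) = dim P"
    by (intro dim_image_eq) auto
  have "subspace (?J ` P)" by (rule linear_subspace_image) (use assms in auto)
  then have "dim {y \<in> UNIV. \<forall>x\<in>?J ` P. orthogonal x y} + dim (?J ` P) = dim (UNIV :: (real^'n) set)"
    by (intro dim_subspace_orthogonal_to_vectors) auto
  \<comment> \<open>The Lorentz complement of P is the Euclidean complement of its image under the
    Gram matrix, so the Euclidean dimension formula applies.\<close>
  moreover have "{y \<in> UNIV. \<forall>x\<in>?J ` P. orthogonal x y} = lor_orth t P"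
    by (auto simp: lor_orth_def orthogonal_def lor_B_J inner_commute)
  ultimately show ?thesis using d by simp
qed

lemma lor_orth_decomp:
  fixes P :: "(real^'n) set"
  assumes "subspace P" "nondegenerate t P"
  obtains p where "p \<in> P" "x - p \<in> lor_orth t P"
proof -
  let ?S = "{p + q | p q. p \<in> P \<and> q \<in> lor_orth t P}"
  have "P \<inter> lor_orth t P = {0}"
    using assms subspace_0[OF assms(1)] subspace_0[OF subspace_lor_orth[of t P]]
    by (auto simp: nondegenerate_def)
  then have "dim ?S = dim P + dim (lor_orth t P)"
    using dim_sums_Int[OF assms(1) subspace_lor_orth, of t P] by simp
  then have "dim ?S = dim (UNIV :: (real^'n) set)" using dim_lor_orth[OF assms(1), of t] by simp
  moreover have "subspace ?S" by (rule subspace_sums) (auto simp: assms subspace_lor_orth)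
  ultimately have "?S = UNIV" by (intro subspace_dim_equal) auto
  then have "x \<in> ?S" by simp
  then show thesis using that by force
qed

lemma dim_nondegenerate_split:
  fixes P :: "(real^'n) set"
  assumes "subspace P" "nondegenerate t P" "subspace W" "P \<subseteq> W"
  shows "dim W = dim P + dim (W \<inter> lor_orth t P)"
proof -
  let ?S = "{p + q | p q. p \<in> P \<and> q \<in> W \<inter> lor_orth t P}"
  have sub: "subspace (W \<inter> lor_orth t P)" using assms(3) subspace_lor_orth by (rule subspace_inter)
  have "?S = W"
  proof
    show "?S \<subseteq> W" using assms(3,4) by (auto intro: subspace_add)
    show "W \<subseteq> ?S"
    proof
      fix x assume x: "x \<in> W"
      obtain p where "p \<in> P" "x - p \<in> lor_orth t P" using lor_orth_decomp[OF assms(1,2)] .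
      then show "x \<in> ?S" using x assms(3,4)
        by (intro CollectI exI[of _ p] exI[of _ "x - p"]) (auto intro: subspace_diff)
    qed
  qed
  moreover have "P \<inter> (W \<inter> lor_orth t P) = {0}"
    using assms subspace_0[OF assms(1)] subspace_0[OF sub]
    by (auto simp: nondegenerate_def)
  ultimately show ?thesis using dim_sums_Int[OF assms(1) sub] by simp
qed

lemma O_image_subspace:
  assumes "T \<in> O_n1 t" "subspace W" "\<And>x. x \<in> W \<Longrightarrow> T *v x \<in> W"
  shows "(*v) T ` W = W"
proof (rule subspace_dim_equal)
  show "subspace ((*v) T ` W)" using assms(2) by (intro linear_subspace_image) auto
  have "dim ((*v) T ` W) = dim W"
    by (intro dim_image_eq) (auto intro!: inj_onI dest: O_inj[OF assms(1)])
  then show "dim W \<le> dim ((*v) T ` W)" by simp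
qed (use assms in auto)

lemma O_lor_orth_invariant:
  assumes "T \<in> O_n1 t" "subspace P" "\<And>x. x \<in> P \<Longrightarrow> T *v x \<in> P" "x \<in> lor_orth t P"
  shows "T *v x \<in> lor_orth t P"
  unfolding lor_orth_def
proof (intro CollectI ballI)
  fix y assume "y \<in> P"
  then obtain z where "z \<in> P" "y = T *v z" using O_image_subspace[OF assms(1-3)] by blast
  then show "lor_B t (T *v x) y = 0" using assms(4) by (simp add: O_B[OF assms(1)] lor_orth_def)
qed

text \<open>Induction on the dimension of \<open>E = ker (A + 1)\<close>: composing A with the reflection in a
  vector of E splits off this vector.\<close>

lemma O_det_minus_one_eigenspace:
  assumes "A \<in> O_n1 t" "pos_def t {x. A *v x = - x}"
  shows "det A = (-1) ^ dim {x. A *v x = - x}"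
  using assms
proof (induction "dim {x. A *v x = - x}" arbitrary: A rule: less_induct)
  case less
  let ?E = "{x. A *v x = - x}"
  have subE: "subspace ?E" by (auto simp: subspace_def algebra_simps)
  show ?case
  proof (cases "?E = {0}")
    case True
    then have "det A = 1" using less.prems(1) by (intro O_det_1[of A t]) auto
    moreover have "dim ?E = 0" by (simp only: True) simp
    ultimately show ?thesis by (simp only: power_0)
  next
    case False
    then obtain v where v: "A *v v = - v" "v \<noteq> 0"
      using subspace_0[OF subE] by blast
    then have Qv: "lor_Q t v > 0" using less.prems(2) by (auto simp: pos_def_def)
    let ?A = "A ** lor_refl t v"
    let ?P = "span {v}"
    have A': "?A \<in> O_n1 t" using less.prems(1) Qv by (intro O_mult lor_refl_O) auto
    have P: "subspace ?P" "?P \<subseteq> ?E"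
      using span_minimal[OF _ subE, of "{v}"] v by auto
    have nd: "nondegenerate t ?P"
      using pos_def_subset[OF less.prems(2) P(2)] by (rule pos_def_nondegenerate)
    have E': "{x. ?A *v x = - x} = ?E \<inter> lor_orth t ?P"
    proof (intro subset_antisym subsetI)
      fix x assume "x \<in> ?E \<inter> lor_orth t ?P"
      then show "x \<in> {x. ?A *v x = - x}"
        by (auto simp: lor_orth_def span_base lor_refl_orth simp flip: matrix_vector_mul_assoc)
    next
      fix x assume "x \<in> {x. ?A *v x = - x}"
      then have x: "A *v (lor_refl t v *v x) = - x" by (simp flip: matrix_vector_mul_assoc)
      \<comment> \<open>The product \<open>A ** lor_refl t v\<close> fixes v, so its eigenvectors
        for -1 must be orthogonal to v.\<close>
      have "lor_B t x v = - lor_B t (A *v (lor_refl t v *v x)) (A *v (lor_refl t v *v v))"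
        using Qv by (simp add: x lor_refl_self v linear_neg[OF matrix_vector_mul_linear])
      also have "\<dots> = - lor_B t x v" using Qv by (simp add: O_B[OF less.prems(1)] O_B[OF lor_refl_O])
      finally have 0: "lor_B t x v = 0" by simp
      then show "x \<in> ?E \<inter> lor_orth t ?P"
        using x by (auto simp: lor_refl_orth lor_orth_def span_singleton)
    qed
    have dim: "dim ?E = 1 + dim {x. ?A *v x = - x}"
      using dim_nondegenerate_split[OF P(1) nd subE P(2)] v(2) by (simp add: E' dim_singleton)
    have "det ?A = (-1) ^ dim {x. ?A *v x = - x}"
      by (rule less.hyps) (use dim A' E' less.prems(2) in \<open>auto intro: pos_def_subset\<close>)
    then show ?thesis using det_lor_refl[OF Qv] by (simp add: det_mul dim)
  qed
qed

subsection \<open>Reversing by products of reflections\<close>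

text \<open>The relation H T H^-1 = T^-1 multiplied out, so that it can be stated on a subspace
  without inverses.\<close>

definition reverses :: "real^'n^'n \<Rightarrow> real^'n^'n \<Rightarrow> (real^'n) set \<Rightarrow> bool" where
  "reverses H T W \<longleftrightarrow> (\<forall>x\<in>W. T *v (H *v (T *v x)) = H *v x)"

text \<open>Reflections in vectors of one summand act trivially on the orthogonal summand, so the
  two reversing products do not interfere.\<close>

lemma reverses_append:
  assumes "subspace W" "set us \<subseteq> P" "set ws \<subseteq> W" "W \<subseteq> lor_orth t P"
    "\<And>x. x \<in> P \<Longrightarrow> T *v x \<in> P" "\<And>x. x \<in> W \<Longrightarrow> T *v x \<in> W"
    "reverses (refl_prod t us) T P" "reverses (refl_prod t ws) T W"
    "x \<in> P" "y \<in> W"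
  shows "T *v (refl_prod t (us @ ws) *v (T *v (x + y))) = refl_prod t (us @ ws) *v (x + y)"
proof -
  let ?U = "refl_prod t us" and ?W = "refl_prod t ws"
  have W: "?W *v z = z" if "z \<in> P" for z
    using that assms(3,4) by (intro refl_prod_orth) (auto simp: lor_orth_def lor_B_commute[of t z])
  have U: "?U *v z = z" if "z \<in> W" for z
    using that assms(2,4) by (intro refl_prod_orth) (auto simp: lor_orth_def)
  have UW: "?W *v z \<in> W" if "z \<in> W" for z
    using assms(1,3) that by (rule refl_prod_in)
  have "refl_prod t (us @ ws) *v (a + b) = ?U *v a + ?W *v b" if "a \<in> P" "b \<in> W" for a b
    using that by (simp add: refl_prod_append matrix_vector_right_distrib W U UW flip: matrix_vector_mul_assoc)
  then show ?thesis using assms(5-10) by (simp add: matrix_vector_right_distrib reverses_def)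
qed

text \<open>The operator T + T^-1 is self-adjoint, so a maximum of its Rayleigh quotient is an
  eigenvector. The quotient is invariant under scaling, which allows maximising over the Euclidean
  unit sphere of W. The conclusion is the eigenvector equation after applying T.\<close>

lemma pos_def_plane:
  assumes T: "T \<in> O_n1 t" and W: "subspace W" "\<And>x. x \<in> W \<Longrightarrow> T *v x \<in> W" "pos_def t W" "W \<noteq> {0}"
  obtains v c where "v \<in> W" "v \<noteq> 0" "T *v (T *v v) = c *\<^sub>R (T *v v) - v"
proof -
  let ?S = "sphere 0 1 \<inter> W"
  let ?f = "\<lambda>x. lor_B t (T *v x) x / lor_Q t x"
  obtain w where w: "w \<in> W" "w \<noteq> 0" using W(1,4) subspace_0 by blast
  have Q: "lor_Q t x > 0" if "x \<in> W" "x \<noteq> 0" for x using that W(3) by (auto simp: pos_def_def)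
  have "compact ?S" by (intro compact_Int_closed compact_sphere closed_subspace W(1))
  moreover have "(1 / norm w) *\<^sub>R w \<in> ?S" using w W(1) by (auto intro: subspace_scale)
  moreover have "continuous_on ?S ?f"
    unfolding lor_B_def lor_Q_eq[symmetric]
  proof (intro continuous_intros)
    show "continuous_on ?S (lor_Q t)" unfolding lor_Q_eq[abs_def] by (intro continuous_intros)
    show "\<forall>x\<in>?S. lor_Q t x \<noteq> 0"
    proof
      fix x assume "x \<in> ?S"
      then have "x \<in> W" "x \<noteq> 0" by auto
      then show "lor_Q t x \<noteq> 0" using Q[of x] by simp
    qed
  qed
  ultimately obtain v where v: "v \<in> ?S" "\<And>x. x \<in> ?S \<Longrightarrow> ?f x \<le> ?f v"
    using continuous_attains_sup[of ?S ?f] by blast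
  define c where "c = ?f v"
  have v0: "v \<noteq> 0" "v \<in> W" using v(1) by auto
  \<comment> \<open>This is the symmetric bilinear form of T + T^-1 - 2c. Maximality makes it
    negative semidefinite on W, with value 0 at v; the next steps conclude that v lies in its
    radical.\<close>
  define q where "q = (\<lambda>x y. lor_B t (T *v x) y + lor_B t (T *v y) x - 2 * c * lor_B t x y)"
  have le: "q x x \<le> 0" if x: "x \<in> W" for x
  proof (cases "x = 0")
    case False
    let ?x = "(1 / norm x) *\<^sub>R x"
    have "?f ?x = ?f x" using False
      by (simp only: matrix_vector_mult_scaleR lor_B_simps lor_Q_scale) (simp add: power2_eq_square)
    moreover have "?x \<in> ?S" using False x W(1) by (auto intro: subspace_scale)
    ultimately have "?f x \<le> c" using v(2)[of ?x] by (simp add: c_def)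
    then show ?thesis using Q[OF x False] by (simp add: q_def lor_B_self divide_le_eq)
  qed (simp add: q_def)
  have qv: "q v v = 0" using Q[OF v0(2,1)] by (simp add: q_def c_def lor_B_self)
  have qw: "q v w = 0" if w: "w \<in> W" for w
  proof -
    have *: "2 * s * q v w + s\<^sup>2 * q w w \<le> 0" for s
    proof -
      have "q (v + s *\<^sub>R w) (v + s *\<^sub>R w) = q v v + 2 * s * q v w + s\<^sup>2 * q w w"
        by (simp add: q_def matrix_vector_right_distrib matrix_vector_mult_scaleR
            lor_B_commute[of t w v] power2_eq_square algebra_simps)
      then show ?thesis using le[of "v + s *\<^sub>R w"] qv w v0 W(1)
        by (simp add: subspace_add subspace_scale)
    qed
    show ?thesis
    proof (rule ccontr)
      assume a: "q v w \<noteq> 0"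
      \<comment> \<open>At s = \<open>q v w / d\<close> the linear term outweighs the quadratic one
        and leaves at least \<open>(q v w)^2 / d\<close>, which is positive.\<close>
      define d where "d = 1 + \<bar>q w w\<bar>"
      have d: "d > 0" "q w w \<ge> - d" by (auto simp: d_def)
      have "2 * (q v w / d) * q v w + (q v w / d)\<^sup>2 * q w w \<ge> 2 * (q v w / d) * q v w - (q v w / d)\<^sup>2 * d"
        using mult_left_mono[OF d(2), of "(q v w / d)\<^sup>2"] by simp
      also have "2 * (q v w / d) * q v w - (q v w / d)\<^sup>2 * d = (q v w)\<^sup>2 / d"
        using d by (simp add: power2_eq_square field_simps)
      finally show False using *[of "q v w / d"] a d
        by (smt (verit) divide_pos_pos zero_less_power2)
    qed
  qed
  \<comment> \<open>This is T applied to (T + T^-1 - 2c) v. It is orthogonal to all of T W = W,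
    hence to itself, and definiteness makes it 0.\<close>
  define z where "z = T *v (T *v v) + v - (2 * c) *\<^sub>R (T *v v)"
  have "z \<in> W" using v0 W(1,2) by (auto simp: z_def intro!: subspace_diff subspace_add subspace_scale)
  moreover have zT: "lor_B t z (T *v w) = q v w" if "w \<in> W" for w
    by (simp add: z_def q_def O_B[OF T] lor_B_commute[of t v])
  obtain w where "w \<in> W" "z = T *v w"
    using \<open>z \<in> W\<close> O_image_subspace[OF T W(1,2)] by blast
  then have "lor_Q t z = 0" using zT qw by (metis lor_B_self)
  ultimately have "z = 0" using Q by force
  then have "T *v (T *v v) = (2 * c) *\<^sub>R (T *v v) - v" by (simp add: z_def algebra_simps)
  then show thesis using that v0 by blast
qed

lemma span_pair: "x \<in> span {v, w} \<longleftrightarrow> (\<exists>a b. x = a *\<^sub>R v + b *\<^sub>R w)"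
  by (simp add: span_insert[of v] span_singleton image_iff algebra_simps)

lemma span_triple:
  "x \<in> span {u, v, w} \<longleftrightarrow> (\<exists>a b c. x = a *\<^sub>R u + b *\<^sub>R v + c *\<^sub>R w)"
  by (simp add: span_insert[of u] span_pair diff_eq_eq add.assoc add.commute[of _ "_ *\<^sub>R u"])

text \<open>The recurrence says T^-1 v = c v - T v, and pairing it with T v gives the product of T v
  and v as half of c times \<open>lor_Q t v\<close>. Therefore the reflection in v sends T v to -
  T^-1 v and v to - v, which is exactly a reversal.\<close>

lemma refl_reverses:
  assumes T: "T \<in> O_n1 t" and v: "T *v (T *v v) = c *\<^sub>R (T *v v) - v" "lor_Q t v \<noteq> 0"
  shows "reverses (lor_refl t v) T (span {v, T *v v})"
    and "x \<in> span {v, T *v v} \<Longrightarrow> T *v x \<in> span {v, T *v v}"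
proof -
  have "lor_B t (T *v (T *v v)) (T *v v) = c * lor_B t (T *v v) (T *v v) - lor_B t v (T *v v)"
    unfolding v(1) by simp
  then have "2 * lor_B t (T *v v) v = c * lor_Q t v"
    by (simp add: O_B[OF T] lor_B_self O_Q[OF T] lor_B_commute[of t v])
  then have RT: "lor_refl t v *v (T *v v) = T *v v - c *\<^sub>R v"
    using v(2) by (simp add: lor_refl_mult)
  have Rv: "lor_refl t v *v v = - v" using v(2) by (rule lor_refl_self)
  note lin = matrix_vector_right_distrib matrix_vector_mult_diff_distrib matrix_vector_mult_scaleR
  show "reverses (lor_refl t v) T (span {v, T *v v})"
    unfolding reverses_def
  proof
    fix x assume "x \<in> span {v, T *v v}"
    then obtain a b where x: "x = a *\<^sub>R v + b *\<^sub>R (T *v v)" using span_pair by blast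
    show "T *v (lor_refl t v *v (T *v x)) = lor_refl t v *v x"
      by (simp add: x lin v(1) RT Rv algebra_simps)
  qed
  show "T *v x \<in> span {v, T *v v}" if "x \<in> span {v, T *v v}"
  proof -
    obtain a b where x: "x = a *\<^sub>R v + b *\<^sub>R (T *v v)" using \<open>x \<in> span {v, T *v v}\<close> span_pair by blast
    have "T *v x = (- b) *\<^sub>R v + (a + b * c) *\<^sub>R (T *v v)"
      by (simp add: x lin v(1) algebra_simps)
    then show ?thesis unfolding span_pair by blast
  qed
qed

text \<open>Each round removes the span of v and T v. On a definite space a real eigenvalue of an
  isometry is 1 or -1, so excluding these forces v and T v to be independent: every round then uses
  one reflection for two dimensions.\<close>

lemma pos_def_reverses:
  assumes T: "T \<in> O_n1 t" and "subspace W" "\<And>x. x \<in> W \<Longrightarrow> T *v x \<in> W" "pos_def t W"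
  shows "\<exists>us. set us \<subseteq> W - {0} \<and> reverses (refl_prod t us) T W \<and>
    ((\<forall>x\<in>W. x \<noteq> 0 \<longrightarrow> T *v x \<noteq> x \<and> T *v x \<noteq> - x) \<longrightarrow> 2 * length us = dim W)"
  using assms(2-)
proof (induction "dim W" arbitrary: W rule: less_induct)
  case less
  show ?case
  proof (cases "W = {0}")
    case True
    then show ?thesis by (intro exI[of _ "[]"]) (simp add: reverses_def)
  next
    case False
    obtain v c where v: "v \<in> W" "v \<noteq> 0" "T *v (T *v v) = c *\<^sub>R (T *v v) - v"
      using pos_def_plane[OF T less.prems False] .
    let ?P = "span {v, T *v v}"
    let ?W = "W \<inter> lor_orth t ?P"
    have Qv: "lor_Q t v > 0" using v less.prems(3) by (auto simp: pos_def_def)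
    have P: "subspace ?P" "?P \<subseteq> W"
      using span_minimal[OF _ less.prems(1), of "{v, T *v v}"] v less.prems(2) by auto
    have nd: "nondegenerate t ?P"
      using pos_def_subset[OF less.prems(3) P(2)] by (rule pos_def_nondegenerate)
    note rev = refl_reverses[OF T v(3) less_imp_neq[OF Qv, symmetric]]
    have W': "subspace ?W" using less.prems(1) subspace_lor_orth by (rule subspace_inter)
    have TW': "T *v x \<in> ?W" if "x \<in> ?W" for x
      using that less.prems(2) O_lor_orth_invariant[OF T P(1) rev(2)] by auto
    have dim: "dim W = dim ?P + dim ?W"
      by (rule dim_nondegenerate_split[OF P(1) nd less.prems(1) P(2)])
    have "dim ?P > 0"
      using dim_subset[of "{v}" ?P] v(2) by (simp add: span_base dim_singleton)
    then have "dim ?W < dim W" using dim by simp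
    from less.hyps[OF this W' TW'] obtain us where us: "set us \<subseteq> ?W - {0}" "reverses (refl_prod t us) T ?W"
      "(\<forall>x\<in>?W. x \<noteq> 0 \<longrightarrow> T *v x \<noteq> x \<and> T *v x \<noteq> - x) \<longrightarrow> 2 * length us = dim ?W"
      using pos_def_subset[OF less.prems(3)] by blast
    have "reverses (refl_prod t (v # us)) T W"
      unfolding reverses_def
    proof
      fix x assume x: "x \<in> W"
      obtain p where p: "p \<in> ?P" "x - p \<in> lor_orth t ?P" using lor_orth_decomp[OF P(1) nd] .
      have "x - p \<in> ?W" using p P(2) x less.prems(1) by (auto intro: subspace_diff)
      moreover have "set us \<subseteq> ?W" using us(1) by blast
      moreover have "reverses (refl_prod t [v]) T ?P" using rev(1) by simp
      ultimately have "T *v (refl_prod t ([v] @ us) *v (T *v (p + (x - p)))) = refl_prod t ([v] @ us) *v (p + (x - p))"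
        using p us(2) by (intro reverses_append[OF W' _ _ _ rev(2) TW']) (auto simp: span_base)
      then show "T *v (refl_prod t (v # us) *v (T *v x)) = refl_prod t (v # us) *v x" by simp
    qed
    moreover have "2 * length (v # us) = dim W" if no: "\<forall>x\<in>W. x \<noteq> 0 \<longrightarrow> T *v x \<noteq> x \<and> T *v x \<noteq> - x"
    proof -
      have "T *v v \<noteq> a *\<^sub>R v" for a
      proof
        assume a: "T *v v = a *\<^sub>R v"
        then have "a\<^sup>2 * lor_Q t v = lor_Q t v" using O_Q[OF T, of v] by (simp add: lor_Q_scale)
        then have "a = 1 \<or> a = -1" using Qv by (simp add: power2_eq_1_iff)
        then show False using a no v by auto
      qed
      then have "T *v v \<notin> span {v}" by (auto simp: span_singleton)
      then have "dim {T *v v, v} = 2"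
        using v(2) by (simp only: dim_insert dim_singleton) simp
      then have "dim ?P = 2" by (simp add: insert_commute)
      moreover have "2 * length us = dim ?W" using us(3) no by blast
      ultimately show ?thesis using dim by simp
    qed
    moreover have "set (v # us) \<subseteq> W - {0}" using us(1) v by auto
    ultimately show ?thesis by blast
  qed
qed

lemma pos_def_reversesE:
  assumes "T \<in> O_n1 t" "subspace W" "\<And>x. x \<in> W \<Longrightarrow> T *v x \<in> W" "pos_def t W"
  obtains us where "set us \<subseteq> W - {0}" "reverses (refl_prod t us) T W"
    "(\<forall>x\<in>W. x \<noteq> 0 \<longrightarrow> T *v x \<noteq> x \<and> T *v x \<noteq> - x) \<longrightarrow> 2 * length us = dim W"
  using pos_def_reverses[of T t W] assms by blast

subsection \<open>Reality and reversing matrices\<close>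

lemma real_in_SOo_iff:
  assumes "T \<in> SOo_n1 t"
  shows "real_in_SOo t T \<longleftrightarrow> (\<exists>h\<in>SOo_n1 t. T ** h ** T = h)"
proof -
  have T: "T ** matrix_inv T = mat 1" "matrix_inv T ** T = mat 1"
    using matrix_inv_cancel O_invertible[OF SOo_O[OF assms]] by auto
  have "h ** T ** matrix_inv h = matrix_inv T \<longleftrightarrow> T ** h ** T = h" if "h \<in> SOo_n1 t" for h
  proof -
    have h: "h ** matrix_inv h = mat 1" "matrix_inv h ** h = mat 1"
      using matrix_inv_cancel O_invertible[OF SOo_O[OF that]] by auto
    show ?thesis
    proof
      assume "h ** T ** matrix_inv h = matrix_inv T"
      then have "T ** (h ** T ** matrix_inv h) ** h = T ** matrix_inv T ** h" by simp
      then show "T ** h ** T = h" using T h by (simp flip: matrix_mul_assoc)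
    next
      assume "T ** h ** T = h"
      then have "matrix_inv T ** (T ** h ** T) ** matrix_inv h = matrix_inv T ** h ** matrix_inv h" by simp
      moreover have "matrix_inv T ** (T ** h ** T) = h ** T" using T by (simp add: matrix_mul_assoc)
      moreover have "matrix_inv T ** h ** matrix_inv h = matrix_inv T" using h by (simp flip: matrix_mul_assoc)
      ultimately show "h ** T ** matrix_inv h = matrix_inv T" by simp
    qed
  qed
  then show ?thesis by (auto simp: real_in_SOo_def)
qed

text \<open>Here "unit" refers to the eigenvalue, 1 or -1, and not to the length of v. This is the
  condition under which the parity of the number of reflections can be switched.\<close>

definition has_space_like_unit_eigenvector :: "'n::finite \<Rightarrow> real^'n^'n \<Rightarrow> bool" where
  "has_space_like_unit_eigenvector t T \<longleftrightarrow> (\<exists>v. lor_Q t v > 0 \<and> (T *v v = v \<or> T *v v = - v))"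

lemma lor_refl_commute:
  assumes T: "T \<in> O_n1 t" and v: "T *v v = v \<or> T *v v = - v"
  shows "lor_refl t v ** T = T ** lor_refl t v"
proof -
  have "lor_refl t v *v (T *v x) = T *v (lor_refl t v *v x)" for x
    using v
  proof
    assume v: "T *v v = v"
    then have "lor_B t (T *v x) v = lor_B t x v" using O_B[OF T, of x v] by simp
    then show ?thesis
      using v by (simp add: lor_refl_mult matrix_vector_mult_diff_distrib matrix_vector_mult_scaleR)
  next
    assume v: "T *v v = - v"
    then have "lor_B t (T *v x) v = - lor_B t x v" using O_B[OF T, of x v] by simp
    then show ?thesis
      using v by (simp add: lor_refl_mult matrix_vector_mult_diff_distrib matrix_vector_mult_scaleR)
  qed
  then show ?thesis by (simp add: matrix_eq flip: matrix_vector_mul_assoc)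
qed

lemma real_of_space_like_unit_eigenvector:
  assumes T: "T \<in> SOo_n1 t" and us: "\<forall>u\<in>set us. lor_Q t u > 0" 
    and rev: "T ** refl_prod t us ** T = refl_prod t us" and "has_space_like_unit_eigenvector t T"
  shows "real_in_SOo t T"
proof -
  obtain v where v: "lor_Q t v > 0" "T *v v = v \<or> T *v v = - v"
    using assms(4) by (auto simp: has_space_like_unit_eigenvector_def)
  show ?thesis
  proof (cases "even (length us)")
    case True
    then show ?thesis unfolding real_in_SOo_iff[OF T] using refl_prod_SOo[OF us] rev by blast
  next
    case False
    have "T ** (refl_prod t us ** lor_refl t v) ** T = T ** refl_prod t us ** (lor_refl t v ** T)"
      by (simp add: matrix_mul_assoc)
    also have "\<dots> = T ** refl_prod t us ** (T ** lor_refl t v)"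
      by (simp only: lor_refl_commute[OF SOo_O[OF T] v(2)])
    also have "\<dots> = refl_prod t us ** lor_refl t v" using rev by (simp add: matrix_mul_assoc)
    finally have "T ** refl_prod t (us @ [v]) ** T = refl_prod t (us @ [v])"
      by (simp add: refl_prod_append)
    moreover have "refl_prod t (us @ [v]) \<in> SOo_n1 t"
      using us v(1) False by (intro refl_prod_SOo) auto
    ultimately show ?thesis unfolding real_in_SOo_iff[OF T] by blast
  qed
qed

text \<open>If h and the product H of an odd number of reflections both reverse T, then g = H h
  commutes with T and has determinant -1. But \<open>ker (g + 1)\<close> is positive definite because g
  preserves a causal ray, and T acts on it without eigenvalues 1 and -1, so its dimension is even.\<close>

lemma not_real_of_odd:
  assumes T: "T \<in> SOo_n1 t" and us: "\<forall>u\<in>set us. lor_Q t u > 0" 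
    and rev: "T ** refl_prod t us ** T = refl_prod t us" and odd: "odd (length us)"
    and no: "\<not> has_space_like_unit_eigenvector t T"
    and e: "lor_Q t e \<le> 0" "e $ t > 0"
      "\<And>g. g \<in> O_n1 t \<Longrightarrow> orthochronous t g \<Longrightarrow> g ** T = T ** g \<Longrightarrow> \<exists>a. g *v e = a *\<^sub>R e"
  shows "\<not> real_in_SOo t T"
proof
  assume "real_in_SOo t T"
  then obtain h where h: "h \<in> SOo_n1 t" "T ** h ** T = h"
    unfolding real_in_SOo_iff[OF T] by blast
  let ?H = "refl_prod t us"
  define g where "g = ?H ** h"
  have TO: "T \<in> O_n1 t" using T by (rule SOo_O)
  have Tinv: "T ** matrix_inv T = mat 1" "matrix_inv T ** T = mat 1"
    using matrix_inv_cancel O_invertible[OF TO] by auto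
  have gO: "g \<in> O_n1 t" unfolding g_def using refl_prod_O[OF us] SOo_O[OF h(1)] by (rule O_mult)
  have go: "orthochronous t g" unfolding g_def
    using refl_prod_orthochronous[OF us] SOo_orthochronous[OF h(1)] SOo_O[OF h(1)] by (rule orthochronous_mult)
  have gT: "g ** T = T ** g"
  proof -
    have "g ** T = T ** ?H ** T ** h ** T" by (simp add: g_def rev)
    also have "\<dots> = T ** ?H ** (T ** h ** T)" by (simp add: matrix_mul_assoc)
    also have "\<dots> = T ** g" by (simp only: h g_def matrix_mul_assoc)
    finally show ?thesis .
  qed
  obtain a where a: "g *v e = a *\<^sub>R e" using e(3)[OF gO go gT] by blast
  \<comment> \<open>Positivity of a is what makes 1 + a nonzero below, so that eigenvectors of g for
    -1 are orthogonal to e and not parallel to it.\<close>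
  have "(g *v e) $ t > 0" using go e(1,2) by (simp add: orthochronous_def)
  then have "a > 0" using a e(2) by (simp add: zero_less_mult_iff)
  let ?E = "{x. g *v x = - x}"
  have subE: "subspace ?E" by (auto simp: subspace_def algebra_simps)
  have pd: "pos_def t ?E"
    unfolding pos_def_def
  proof (intro ballI impI)
    fix x assume x: "x \<in> ?E" "x \<noteq> 0"
    have "lor_B t x e = - (a * lor_B t x e)" using O_B[OF gO, of x e] x a by simp
    then have "(1 + a) * lor_B t x e = 0" by (simp add: algebra_simps)
    then have "lor_B t x e = 0" using \<open>a > 0\<close> by simp
    moreover have e0: "e \<noteq> 0" using e(2) by auto
    moreover have "x \<noteq> c *\<^sub>R e" for c
    proof
      assume c: "x = c *\<^sub>R e"
      then have "(c * (a + 1)) *\<^sub>R e = 0" using x(1) a by (simp add: matrix_vector_mult_scaleR algebra_simps)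
      then show False using e0 \<open>a > 0\<close> c x(2) by auto
    qed
    ultimately show "lor_Q t x > 0" using orth_causal[OF e(1)] by blast
  qed
  have TE: "T *v x \<in> ?E" if "x \<in> ?E" for x
  proof -
    have "g *v (T *v x) = T *v (g *v x)" by (simp add: matrix_vector_mul_assoc gT)
    then show ?thesis using that by (simp add: linear_neg[OF matrix_vector_mul_linear])
  qed
  have ev: "T *v x \<noteq> x \<and> T *v x \<noteq> - x" if "x \<in> ?E" "x \<noteq> 0" for x
    using no pd that unfolding has_space_like_unit_eigenvector_def pos_def_def by blast
  obtain ws where "set ws \<subseteq> ?E - {0}" "reverses (refl_prod t ws) T ?E" 
     "(\<forall>x\<in>?E. x \<noteq> 0 \<longrightarrow> T *v x \<noteq> x \<and> T *v x \<noteq> - x) \<longrightarrow> 2 * length ws = dim ?E"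
    by (rule pos_def_reversesE[OF TO subE TE pd])
  with ev have "even (dim ?E)" by presburger
  then have "det g = 1" using O_det_minus_one_eigenspace[OF gO pd] by simp
  moreover have "det g = -1" using det_refl_prod[OF us] odd SOo_det[OF h(1)] by (simp add: g_def det_mul)
  ultimately show False by simp
qed

text \<open>A time-like vector in P makes P nondegenerate and its complement positive definite, so
  the definite case finishes the job. The complement has dimension \<open>CARD('n)\<close> minus
  \<open>dim P\<close> and contributes half of that many reflections; the count is written
  additively to avoid subtraction of naturals.\<close>

lemma reverses_extend:
  fixes T :: "real^'n^'n"
  assumes T: "T \<in> O_n1 t" and P: "subspace P" "\<And>x. x \<in> P \<Longrightarrow> T *v x \<in> P" "p \<in> P" "lor_Q t p < 0"
    and us: "set us \<subseteq> P" "\<forall>u\<in>set us. lor_Q t u > 0" "reverses (refl_prod t us) T P"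
  obtains ws where "\<forall>u\<in>set ws. lor_Q t u > 0" "T ** refl_prod t ws ** T = refl_prod t ws"
    "\<not> has_space_like_unit_eigenvector t T \<longrightarrow> 2 * length ws + dim P = CARD('n) + 2 * length us"
proof -
  let ?W = "lor_orth t P"
  have nd: "nondegenerate t P" using P(3,4) by (rule time_like_nondegenerate)
  have pd: "pos_def t ?W" using P(3,4) by (rule time_like_orth_pos_def)
  have TW: "T *v x \<in> ?W" if "x \<in> ?W" for x using O_lor_orth_invariant[OF T P(1,2) that] .
  obtain vs where vs: "set vs \<subseteq> ?W - {0}" "reverses (refl_prod t vs) T ?W"
    "(\<forall>x\<in>?W. x \<noteq> 0 \<longrightarrow> T *v x \<noteq> x \<and> T *v x \<noteq> - x) \<longrightarrow> 2 * length vs = dim ?W"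
    by (rule pos_def_reversesE[OF T subspace_lor_orth TW pd])
  have "T *v (refl_prod t (us @ vs) *v (T *v x)) = refl_prod t (us @ vs) *v x" for x
  proof -
    obtain q where q: "q \<in> P" "x - q \<in> ?W" using lor_orth_decomp[OF P(1) nd] .
    have "T *v (refl_prod t (us @ vs) *v (T *v (q + (x - q)))) = refl_prod t (us @ vs) *v (q + (x - q))"
      using us(1,3) vs(1,2) P(2) TW q by (intro reverses_append[OF subspace_lor_orth]) auto
    then show ?thesis by simp
  qed
  then have "T ** refl_prod t (us @ vs) ** T = refl_prod t (us @ vs)"
    by (simp add: matrix_eq flip: matrix_vector_mul_assoc)
  moreover have "\<forall>u\<in>set (us @ vs). lor_Q t u > 0" using us(2) vs(1) pd by (auto simp: pos_def_def)
  moreover have "2 * length (us @ vs) + dim P = CARD('n) + 2 * length us"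
    if "\<not> has_space_like_unit_eigenvector t T"
  proof -
    have "T *v x \<noteq> x \<and> T *v x \<noteq> - x" if "x \<in> ?W" "x \<noteq> 0" for x
      using \<open>\<not> has_space_like_unit_eigenvector t T\<close> pd that
      unfolding has_space_like_unit_eigenvector_def pos_def_def by blast
    with vs(3) have "2 * length vs = dim ?W" by blast
    then show ?thesis using dim_lor_orth[OF P(1), of t] by simp
  qed
  ultimately show thesis using that by blast
qed

subsection \<open>Fixed causal directions\<close>

text \<open>Brouwer's theorem is applied to the action of T on the slice at time coordinate 1 of the
  causal cone, with T x rescaled back to the slice.\<close>

lemma causal_eigenvector:
  fixes T :: "real^'n^'n"
  assumes "T \<in> O_n1 t" "orthochronous t T"
  obtains e r where "lor_Q t e \<le> 0" "e $ t > 0" "r > 0" "T *v e = r *\<^sub>R e"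
proof -
  \<comment> \<open>At time coordinate 1, a vector is causal exactly when its Euclidean square is at
    most 2; hence the radius.\<close>
  let ?S = "cball 0 (sqrt 2) \<inter> {x. (axis t 1 :: real^'n) \<bullet> x = 1}"
  have S: "x \<in> ?S \<longleftrightarrow> x $ t = 1 \<and> lor_Q t x \<le> 0" for x
  proof -
    have "norm x \<le> sqrt 2 \<longleftrightarrow> x \<bullet> x \<le> 2" by (simp add: norm_eq_sqrt_inner)
    then show ?thesis by (auto simp: inner_axis' lor_Q_eq)
  qed
  let ?f = "\<lambda>x. (1 / (T *v x) $ t) *\<^sub>R (T *v x)"
  have pos: "(T *v x) $ t > 0" if "x \<in> ?S" for x
    using that assms(2) by (simp add: S orthochronous_def del: Int_iff)
  have "compact ?S" by (rule compact_Int_closed[OF compact_cball closed_hyperplane])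
  moreover have "convex ?S" by (rule convex_Int[OF convex_cball convex_hyperplane])
  moreover have "axis t 1 \<in> ?S" by (simp add: S lor_Q_axis_time del: Int_iff)
  then have "?S \<noteq> {}" by blast
  moreover have "continuous_on ?S ?f"
    by (intro continuous_intros) (use pos in force)
  moreover have "?f \<in> ?S \<rightarrow> ?S"
  proof
    fix x assume x: "x \<in> ?S"
    then have "lor_Q t x \<le> 0" using S by blast
    then show "?f x \<in> ?S"
      using pos[OF x] by (simp add: S lor_Q_scale O_Q[OF assms(1)] zero_le_mult_iff mult_le_0_iff divide_le_0_iff del: Int_iff)
  qed
  ultimately obtain x where x: "x \<in> ?S" "?f x = x" by (rule brouwer)
  have "T *v x = ((T *v x) $ t) *\<^sub>R ?f x" using pos[OF x(1)] by simp
  then have "T *v x = ((T *v x) $ t) *\<^sub>R x" by (simp only: x(2))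
  moreover have "lor_Q t x \<le> 0" "x $ t > 0" using x(1) by (auto simp: S simp del: Int_iff)
  ultimately show thesis using that pos[OF x(1)] by blast
qed

text \<open>The identity has such an axis too, so this predicate and the two that follow cover every
  orthochronous isometry.\<close>

definition elliptic_axis :: "'n::finite \<Rightarrow> real^'n^'n \<Rightarrow> real^'n \<Rightarrow> bool" where
  "elliptic_axis t T p \<longleftrightarrow> lor_Q t p < 0 \<and> p $ t > 0 \<and> T *v p = p"

definition boost_axis :: "'n::finite \<Rightarrow> real^'n^'n \<Rightarrow> real \<Rightarrow> real^'n \<Rightarrow> bool" where
  "boost_axis t T r e \<longleftrightarrow> lor_Q t e = 0 \<and> e $ t > 0 \<and> r > 0 \<and> r \<noteq> 1 \<and> T *v e = r *\<^sub>R e"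

definition parabolic_axis :: "'n::finite \<Rightarrow> real^'n^'n \<Rightarrow> real^'n \<Rightarrow> bool" where
  "parabolic_axis t T e \<longleftrightarrow> lor_Q t e = 0 \<and> e $ t > 0 \<and> T *v e = e \<and> (\<forall>p. lor_Q t p < 0 \<longrightarrow> T *v p \<noteq> p)"

lemma elliptic_axisI:
  assumes "lor_Q t p < 0" "T *v p = p"
  shows "\<exists>p. elliptic_axis t T p"
proof -
  have "p $ t \<noteq> 0" by (rule causal_time_nonzero) (use assms lor_Q_eq[of t 0] in auto)
  then consider "p $ t > 0" | "(- p) $ t > 0" by fastforce
  then show ?thesis
  proof cases
    case 2
    moreover have "lor_Q t (- p) < 0" using assms(1) by (simp add: lor_Q_eq)
    ultimately show ?thesis
      using assms(2) by (auto simp: elliptic_axis_def linear_neg[OF matrix_vector_mul_linear] intro!: exI[of _ "- p"])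
  qed (use assms in \<open>auto simp: elliptic_axis_def\<close>)
qed

lemma axis_cases:
  assumes "T \<in> O_n1 t" "orthochronous t T"
  obtains p where "elliptic_axis t T p" | r e where "boost_axis t T r e" | e where "parabolic_axis t T e"
proof -
  obtain e r where e: "lor_Q t e \<le> 0" "e $ t > 0" "r > 0" "T *v e = r *\<^sub>R e"
    using causal_eigenvector[OF assms] .
  show thesis
  proof (cases "lor_Q t e < 0")
    case True
    have "r\<^sup>2 * lor_Q t e = lor_Q t e" using O_Q[OF assms(1), of e] by (simp add: e lor_Q_scale)
    then have "r\<^sup>2 = 1" using True by simp
    then have "r = 1" using e(3) by (simp add: power2_eq_1_iff)
    then show thesis using that(1)[of e] True e by (simp add: elliptic_axis_def)
  next
    case False
    then have e0: "lor_Q t e = 0" using e(1) by simp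
    show thesis
    proof (cases "r = 1")
      case False
      then have "boost_axis t T r e" using e e0 by (simp add: boost_axis_def)
      then show thesis by (rule that(2))
    next
      case True
      show thesis
      proof (cases "\<exists>p. lor_Q t p < 0 \<and> T *v p = p")
        case True
        then show thesis using elliptic_axisI[of t _ T] that(1) by blast
      next
        case False
        then have "parabolic_axis t T e" using e e0 \<open>r = 1\<close> by (simp add: parabolic_axis_def)
        then show thesis by (rule that(3))
      qed
    qed
  qed
qed

text \<open>Along the light-like direction e the form is affine in s with nonzero slope, so every
  value is attained; the witness gives -1.\<close>

lemma time_like_shift:
  assumes "lor_Q t e = 0" "lor_B t z e \<noteq> 0"
  shows "\<exists>s. lor_Q t (z + s *\<^sub>R e) < 0"
proof -
  have *: "lor_Q t (z + s *\<^sub>R e) = lor_Q t z + 2 * s * lor_B t z e" for s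
    using assms(1) by (simp add: lor_B_commute[of t e z] flip: lor_B_self)
  show ?thesis
    by (rule exI[of _ "- (lor_Q t z + 1) / (2 * lor_B t z e)"]) (unfold *, use assms(2) in \<open>simp add: field_simps\<close>)
qed

text \<open>If x and e were not orthogonal, a shift of x along e would be a time-like fixed
  vector.\<close>

lemma parabolic_axis_fixed:
  assumes "parabolic_axis t T e" "T *v x = x"
  shows "lor_B t x e = 0"
proof (rule ccontr)
  assume "lor_B t x e \<noteq> 0"
  then obtain s where "lor_Q t (x + s *\<^sub>R e) < 0"
    using time_like_shift[of t e x] assms(1) by (auto simp: parabolic_axis_def)
  moreover have "T *v (x + s *\<^sub>R e) = x + s *\<^sub>R e"
    using assms by (simp add: parabolic_axis_def matrix_vector_right_distrib matrix_vector_mult_scaleR)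
  ultimately show False using assms(1) by (auto simp: parabolic_axis_def)
qed

lemma boost_axis_orth:
  assumes "T \<in> O_n1 t" "boost_axis t T r e" "T *v x = c *\<^sub>R x" "r * c \<noteq> 1"
  shows "lor_B t x e = 0"
proof -
  have "lor_B t (c *\<^sub>R x) (r *\<^sub>R e) = lor_B t x e"
    using O_B[OF assms(1), of x e] assms(2,3) by (simp only: boost_axis_def)
  then have "(r * c - 1) * lor_B t x e = 0" by (simp only: lor_B_simps) (simp add: algebra_simps)
  then show ?thesis using assms(4) by simp
qed

lemma mat_mult_vector: "mat c *v x = c *\<^sub>R (x :: real^'n)"
  by (simp add: matrix_vector_mult_def mat_def vec_eq_iff if_distrib if_distribR cong del: if_weak_cong)

text \<open>An isometry is conjugate to the transpose of its inverse, so 1/r is an eigenvalue along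
  with r. Its eigenvector is light-like, because its eigenvalue has square different from 1; if it
  were orthogonal to e it would be parallel to e, forcing r = 1/r.\<close>

lemma boost_axis_second:
  fixes T :: "real^'n^'n"
  assumes T: "T \<in> O_n1 t" and e: "boost_axis t T r e"
  obtains f where "f \<noteq> 0" "T *v f = (1 / r) *\<^sub>R f" "lor_Q t f = 0" "lor_B t f e \<noteq> 0"
proof -
  have r: "r > 0" "r \<noteq> 1" "T *v e = r *\<^sub>R e" "e \<noteq> 0" "lor_Q t e = 0"
    using e by (auto simp: boost_axis_def)
  have sub: "(T - mat c) *v x = T *v x - c *\<^sub>R x" for c x
    by (simp add: matrix_vector_mult_diff_rdistrib mat_mult_vector)
  have ker: "det (T - mat c) = 0 \<longleftrightarrow> (\<exists>x. x \<noteq> 0 \<and> T *v x = c *\<^sub>R x)" for c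
  proof -
    have "det (T - mat c) \<noteq> 0 \<longleftrightarrow> inj ((*v) (T - mat c))"
      using det_nz_iff_inj[of "(*v) (T - mat c)"] by simp
    also have "\<dots> \<longleftrightarrow> (\<forall>x. T *v x = c *\<^sub>R x \<longrightarrow> x = 0)"
      unfolding linear_injective_0[OF matrix_vector_mul_linear] sub right_minus_eq ..
    finally show ?thesis by blast
  qed
  define M where "M = transpose T"
  have MJ: "M *v (lor_J t *v (T *v x)) = lor_J t *v x" for x
    unfolding M_def by (simp only: matrix_vector_mul_assoc matrix_mul_assoc O_J[OF T])
  \<comment> \<open>Taking determinants in this identity transfers the vanishing of det (T - r) to
    det (T - 1/r).\<close>
  have "(M ** lor_J t ** (T - mat (1/r))) *v x = (mat (- 1/r) ** ((M - mat r) ** lor_J t)) *v x" for x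
  proof -
    have "(M ** lor_J t ** (T - mat (1/r))) *v x = lor_J t *v x - (1/r) *\<^sub>R (M *v (lor_J t *v x))"
      by (simp only: matrix_vector_mul_assoc[symmetric] matrix_vector_mult_diff_rdistrib
          matrix_vector_mult_diff_distrib mat_mult_vector matrix_vector_mult_scaleR MJ)
    also have "\<dots> = (- 1/r) *\<^sub>R (M *v (lor_J t *v x) - r *\<^sub>R (lor_J t *v x))"
      using r(1) by (simp add: scaleR_diff_right)
    also have "\<dots> = (mat (- 1/r) ** ((M - mat r) ** lor_J t)) *v x"
      by (simp only: matrix_vector_mul_assoc[symmetric] mat_mult_vector matrix_vector_mult_diff_rdistrib)
    finally show ?thesis .
  qed
  then have "M ** lor_J t ** (T - mat (1/r)) = mat (- 1/r) ** ((M - mat r) ** lor_J t)"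
    unfolding matrix_eq by (rule allI)
  from arg_cong[OF this, of det]
  have "det M * det (lor_J t) * det (T - mat (1/r)) = det (mat (- 1/r) :: real^'n^'n) * (det (M - mat r) * det (lor_J t))"
    by (simp only: det_mul)
  moreover have "M - mat r = transpose (T - mat r)"
    unfolding M_def transpose_def vec_eq_iff mat_def by auto
  then have "det (M - mat r) = det (T - mat r)" by (simp only: det_transpose)
  then have "det (M - mat r) = 0" using ker[of r] r(3,4) by auto
  moreover have "det M \<noteq> 0" unfolding M_def det_transpose using O_det_sq[OF T] by auto
  ultimately have "det (T - mat (1/r)) = 0" using det_lor_J[of t] by simp
  then obtain f where f: "f \<noteq> 0" "T *v f = (1 / r) *\<^sub>R f" using ker by blast
  have "(1/r)\<^sup>2 * lor_Q t f = lor_Q t f" using O_Q[OF T, of f] by (simp add: f lor_Q_scale)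
  moreover have "1/r > 0" "1/r \<noteq> 1" using r(1,2) by auto
  then have "(1/r)\<^sup>2 \<noteq> 1" unfolding power2_eq_1_iff by linarith
  ultimately have Qf: "lor_Q t f = 0" by simp
  moreover have "lor_B t f e \<noteq> 0"
  proof
    assume 0: "lor_B t f e = 0"
    obtain c where c: "f = c *\<^sub>R e" using orth_light_like(2)[OF r(5,4) 0 Qf] ..
    have "c *\<^sub>R (r *\<^sub>R e) = (1/r) *\<^sub>R (c *\<^sub>R e)"
      using f(2) unfolding c matrix_vector_mult_scaleR r(3) .
    then have "(c * (r - 1/r)) *\<^sub>R e = 0"
      unfolding scaleR_scaleR right_diff_distrib scaleR_diff_left by (simp add: mult.commute)
    then have "c = 0 \<or> r - 1/r = 0" using r(4) by simp
    moreover have "r * r \<noteq> 1" using r(1,2) by (simp add: power2_eq_1_iff flip: power2_eq_square)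
    then have "r - 1/r \<noteq> 0" using r(1) by (simp add: field_simps)
    ultimately show False using c f(1) by simp
  qed
  ultimately show thesis using that f by blast
qed

section \<open>Reversing T near each kind of axis\<close>

lemma elliptic_axis_reverses:
  fixes T :: "real^'n^'n"
  assumes T: "T \<in> O_n1 t" and p: "elliptic_axis t T p"
  obtains us where "\<forall>u\<in>set us. lor_Q t u > 0" "T ** refl_prod t us ** T = refl_prod t us"
    "\<not> has_space_like_unit_eigenvector t T \<longrightarrow> 2 * length us + 1 = CARD('n)"
proof -
  let ?P = "span {p}"
  have p': "lor_Q t p < 0" "T *v p = p" "p \<noteq> 0" using p by (auto simp: elliptic_axis_def)
  have Tx: "T *v x = x" if "x \<in> ?P" for x
    using that p' by (auto simp: span_singleton matrix_vector_mult_scaleR)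
  have d: "dim ?P = 1" using p'(3) by (simp add: dim_singleton)
  have TP: "T *v x \<in> ?P" if "x \<in> ?P" for x using Tx that by simp
  have rev: "reverses (refl_prod t []) T ?P" using Tx by (simp add: reverses_def)
  obtain us where "\<forall>u\<in>set us. lor_Q t u > 0" "T ** refl_prod t us ** T = refl_prod t us"
    "\<not> has_space_like_unit_eigenvector t T \<longrightarrow> 2 * length us + dim ?P = CARD('n) + 2 * length ([] :: (real^'n) list)"
    by (rule reverses_extend[OF T subspace_span TP span_base p'(1) _ _ rev]) auto
  then show thesis using that d by auto
qed

lemma boost_axis_reverses:
  fixes T :: "real^'n^'n"
  assumes T: "T \<in> O_n1 t" and e: "boost_axis t T r e"
  obtains us where "\<forall>u\<in>set us. lor_Q t u > 0" "T ** refl_prod t us ** T = refl_prod t us"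
    "\<not> has_space_like_unit_eigenvector t T \<longrightarrow> 2 * length us = CARD('n)"
proof -
  have e': "lor_Q t e = 0" "r > 0" "T *v e = r *\<^sub>R e" "e \<noteq> 0"
    using e by (auto simp: boost_axis_def)
  obtain f where f: "f \<noteq> 0" "T *v f = (1 / r) *\<^sub>R f" "lor_Q t f = 0" "lor_B t f e \<noteq> 0"
    using boost_axis_second[OF T e] .
  define b where "b = lor_B t f e"
  have B: "lor_B t e e = 0" "lor_B t f f = 0" "lor_B t f e = b" "lor_B t e f = b" "b \<noteq> 0"
    using e'(1) f(3,4) by (auto simp: lor_B_self b_def lor_B_commute[of t e f])
  let ?P = "span {e, f}"
  \<comment> \<open>The factor 1/b normalises f so that the reflection in v exchanges the two
    light-like lines, up to sign. This interchanges the eigenvalues r and 1/r, and so reverses T on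
    the plane. The difference of the same two vectors is time-like.\<close>
  let ?v = "e + (1/b) *\<^sub>R f"
  let ?p = "e - (1/b) *\<^sub>R f"
  note lin = matrix_vector_right_distrib matrix_vector_mult_scaleR
  have Qv: "lor_Q t ?v = 2" using B by (simp flip: lor_B_self)
  have Qp: "lor_Q t ?p < 0" using B by (simp flip: lor_B_self)
  have v: "?v \<in> ?P" and p: "?p \<in> ?P"
    by (intro span_add span_diff span_scale span_base; simp)+
  have Re: "lor_refl t ?v *v e = - (1/b) *\<^sub>R f" and Rf: "lor_refl t ?v *v f = (- b) *\<^sub>R e"
    using B by (simp_all add: lor_refl_mult Qv scaleR_add_right)
  have TP: "T *v x \<in> ?P" if x: "x \<in> ?P" for x
  proof -
    obtain a c where "x = a *\<^sub>R e + c *\<^sub>R f" using x unfolding span_pair by blast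
    then have "T *v x = (a * r) *\<^sub>R e + (c / r) *\<^sub>R f" by (simp add: lin e'(3) f(2))
    then show ?thesis unfolding span_pair by blast
  qed
  have rev: "reverses (refl_prod t [?v]) T ?P"
    unfolding reverses_def
  proof
    fix x assume "x \<in> ?P"
    then obtain a c where x: "x = a *\<^sub>R e + c *\<^sub>R f" unfolding span_pair by blast
    have H: "refl_prod t [?v] = lor_refl t ?v" by simp
    have T1: "T *v x = (a * r) *\<^sub>R e + (c / r) *\<^sub>R f" by (simp add: x lin e'(3) f(2))
    have T2: "lor_refl t ?v *v (T *v x) = (- (c / r) * b) *\<^sub>R e + (- (a * r) / b) *\<^sub>R f"
      unfolding T1 lin Re Rf by simp
    have "T *v (lor_refl t ?v *v (T *v x)) = (- c * b) *\<^sub>R e + (- a / b) *\<^sub>R f"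
      unfolding T2 lin e'(3) f(2) using e'(2) by simp
    also have "\<dots> = lor_refl t ?v *v x" unfolding x lin Re Rf by simp
    finally show "T *v (refl_prod t [?v] *v (T *v x)) = refl_prod t [?v] *v x" unfolding H .
  qed
  have "f \<noteq> a *\<^sub>R e" for a using B by auto
  then have "f \<notin> span {e}" by (auto simp: span_singleton)
  then have "dim {f, e} = 2" using e'(4) by (simp only: dim_insert dim_singleton) simp
  then have d: "dim ?P = 2" by (simp add: insert_commute)
  have sp: "set [?v] \<subseteq> ?P" "\<forall>u\<in>set [?v]. lor_Q t u > 0" using v Qv by auto
  obtain us where "\<forall>u\<in>set us. lor_Q t u > 0" "T ** refl_prod t us ** T = refl_prod t us"
    "\<not> has_space_like_unit_eigenvector t T \<longrightarrow> 2 * length us + dim ?P = CARD('n) + 2 * length [?v]"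
    by (rule reverses_extend[OF T subspace_span TP p Qp sp rev])
  then show thesis using that d by auto
qed

lemma lor_orth_lor_orth:
  fixes P :: "(real^'n) set"
  assumes "subspace P"
  shows "lor_orth t (lor_orth t P) = P"
proof (rule subspace_dim_equal[symmetric])
  show "P \<subseteq> lor_orth t (lor_orth t P)"
    by (auto simp: lor_orth_def lor_B_commute)
  show "dim (lor_orth t (lor_orth t P)) \<le> dim P"
    using dim_lor_orth[OF assms, of t] dim_lor_orth[OF subspace_lor_orth, of t t P] by simp
qed (use assms subspace_lor_orth in auto)

text \<open>For an isometry the orthogonal complement of the range of T - 1 is the kernel of T - 1,
  and taking complements twice returns the range. This is how Jordan chains are lifted
  below.\<close>

lemma orth_fixed_in_range:
  fixes T :: "real^'n^'n"
  assumes T: "T \<in> O_n1 t" and x: "\<And>y. T *v y = y \<Longrightarrow> lor_B t x y = 0"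
  obtains z where "T *v z - z = x"
proof -
  let ?R = "range (\<lambda>z. T *v z - z)"
  have "linear (\<lambda>z. T *v z - z)" by (intro linear_compose_sub) (auto simp: linear_id[unfolded id_def])
  then have R: "subspace ?R" by (rule linear_subspace_image) simp
  have "T *v y = y" if y: "y \<in> lor_orth t ?R" for y
  proof -
    have "lor_B t (T *v y - y) (T *v z) = 0" for z
    proof -
      have "lor_B t y (T *v z - z) = 0" using y by (auto simp: lor_orth_def)
      then show ?thesis by (simp add: O_B[OF T])
    qed
    moreover have "(*v) T ` UNIV = UNIV" by (rule O_image_subspace[OF T]) auto
    then have "lor_J t *v (T *v y - y) \<in> range ((*v) T)" by simp
    then obtain z where "lor_J t *v (T *v y - y) = T *v z" by blast
    \<comment> \<open>Testing against the Gram image turns the Lorentz product into a Euclidean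
      square, since \<open>lor_J\<close> is an involution.\<close>
    ultimately have "lor_B t (T *v y - y) (lor_J t *v (T *v y - y)) = 0" by simp
    then have "(T *v y - y) \<bullet> (lor_J t *v (lor_J t *v (T *v y - y))) = 0"
      by (simp only: lor_B_J)
    moreover have "lor_J t *v (lor_J t *v w) = w" for w :: "real^'n"
      by (simp add: lor_J_mult flip: scaleR_add_left)
    ultimately show ?thesis by simp
  qed
  then have "x \<in> lor_orth t (lor_orth t ?R)"
    using x unfolding lor_orth_def[of t "lor_orth t ?R"] by blast
  then have "x \<in> ?R" by (simp only: lor_orth_lor_orth[OF R])
  then show thesis using that by auto
qed

lemma parabolic_axis_reverses:
  fixes T :: "real^'n^'n"
  assumes T: "T \<in> O_n1 t" and e: "parabolic_axis t T e"
  obtains us where "\<forall>u\<in>set us. lor_Q t u > 0" "T ** refl_prod t us ** T = refl_prod t us"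
    "\<not> has_space_like_unit_eigenvector t T \<longrightarrow> 2 * length us + 1 = CARD('n)"
proof -
  have e': "lor_Q t e = 0" "T *v e = e" "e \<noteq> 0" "e $ t \<noteq> 0"
    using e by (auto simp: parabolic_axis_def)
  have Bee: "lor_B t e e = 0" using e'(1) by (simp add: lor_B_self)
  note fixed = parabolic_axis_fixed[OF e]
  obtain y0 where y0: "T *v y0 - y0 = e"
    using orth_fixed_in_range[OF T, of e] fixed unfolding lor_B_commute[of t e] by blast
  \<comment> \<open>A Jordan chain T - 1 : z to y to e is wanted. To lift y0 once more it must be
    orthogonal to all fixed vectors, so its component in \<open>?F\<close> is removed. Together with
    e, \<open>?F\<close> spans the fixed space, and it is definite because its time coordinate
    vanishes.\<close>
  let ?F = "{x. T *v x = x \<and> x $ t = 0}"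
  have F: "subspace ?F" by (auto simp: subspace_def matrix_vector_right_distrib matrix_vector_mult_scaleR)
  have "nondegenerate t ?F"
    by (rule pos_def_nondegenerate) (auto simp: pos_def_def lor_Q_time_zero)
  then obtain f where f: "f \<in> ?F" "y0 - f \<in> lor_orth t ?F" using lor_orth_decomp[OF F] by blast
  define y where "y = y0 - f"
  have Ty: "T *v y = y + e"
    using y0 f(1) by (simp add: y_def matrix_vector_mult_diff_distrib algebra_simps)
  have "lor_Q t (y + e) = lor_Q t y" using O_Q[OF T, of y] by (simp add: Ty)
  then have Bye: "lor_B t y e = 0" using Bee by (simp add: lor_B_commute[of t e y] flip: lor_B_self)
  have "lor_B t y x = 0" if x: "T *v x = x" for x
  proof -
    let ?x = "x - (x $ t / e $ t) *\<^sub>R e"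
    have "?x \<in> ?F" using e' x by (simp add: matrix_vector_mult_diff_distrib matrix_vector_mult_scaleR)
    then have "lor_B t y ?x = 0" using f(2) unfolding y_def[symmetric] lor_orth_def by blast
    then show ?thesis using Bye by simp
  qed
  then obtain z where z: "T *v z - z = y" using orth_fixed_in_range[OF T, of y] by blast
  \<comment> \<open>v is \<open>(log T) z\<close>; the logarithm makes the reversing involution the plain reflection in v.\<close>
  define v where "v = y - (1/2) *\<^sub>R e"
  have Tv: "T *v v = v + e"
    by (simp add: v_def matrix_vector_mult_diff_distrib matrix_vector_mult_scaleR Ty e'(2))
  have Tz: "T *v z = z + v + (1/2) *\<^sub>R e" using z by (simp add: v_def algebra_simps)
  have Bve: "lor_B t v e = 0" "lor_B t e v = 0"
    using Bye Bee by (auto simp: v_def lor_B_commute[of t e y])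
  have Qv: "lor_Q t v > 0"
  proof (rule orth_causal[of t e])
    show "v \<noteq> a *\<^sub>R e" for a
      using Tv e'(2,3) by (auto simp: matrix_vector_mult_scaleR)
  qed (use e' Bve in auto)
  \<comment> \<open>Invariance of the form on this pair and on z with itself determines the products
    of z with e and v. In particular z is orthogonal to v, so the reflection in v fixes e and
    z.\<close>
  have "lor_B t (T *v z) (T *v v) = lor_B t z v" by (rule O_B[OF T])
  then have Bze: "lor_B t z e = - lor_Q t v"
    using Bve Bee by (simp add: Tz Tv lor_B_self)
  have "lor_B t (T *v z) (T *v z) = lor_B t z z" by (rule O_B[OF T])
  then have Bzv: "lor_B t z v = 0"
    using Bve Bee Bze lor_B_self[of t v]
    by (simp add: Tz lor_B_commute[of t v z] lor_B_commute[of t e z])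
  let ?P = "span {e, v, z}"
  note lin = matrix_vector_right_distrib matrix_vector_mult_scaleR
  have Re: "lor_refl t v *v e = e" and Rv: "lor_refl t v *v v = - v" and Rz: "lor_refl t v *v z = z"
    using Bve Bzv Qv by (auto simp: lor_refl_orth lor_refl_self)
  \<comment> \<open>The span of e, v and z is time-like because z is not orthogonal to the
    light-like e.\<close>
  obtain s where s: "lor_Q t (z + s *\<^sub>R e) < 0"
    using time_like_shift[OF e'(1), of z] Bze Qv by auto
  have p: "z + s *\<^sub>R e \<in> ?P" by (intro span_add span_scale span_base) auto
  have T1: "T *v (a *\<^sub>R e + b *\<^sub>R v + c *\<^sub>R z) = (a + b + c/2) *\<^sub>R e + (b + c) *\<^sub>R v + c *\<^sub>R z" for a b c
    by (simp add: lin e'(2) Tv Tz algebra_simps)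
  have R1: "lor_refl t v *v (a *\<^sub>R e + b *\<^sub>R v + c *\<^sub>R z) = a *\<^sub>R e + (- b) *\<^sub>R v + c *\<^sub>R z" for a b c
    by (simp add: lin Re Rv Rz)
  have TP: "T *v x \<in> ?P" if x: "x \<in> ?P" for x
  proof -
    obtain a b c where "x = a *\<^sub>R e + b *\<^sub>R v + c *\<^sub>R z" using x unfolding span_triple by blast
    then show ?thesis unfolding span_triple using T1 by blast
  qed
  have rev: "reverses (refl_prod t [v]) T ?P"
    unfolding reverses_def
  proof
    fix x assume "x \<in> ?P"
    then obtain a b c where x: "x = a *\<^sub>R e + b *\<^sub>R v + c *\<^sub>R z" unfolding span_triple by blast
    have H: "refl_prod t [v] = lor_refl t v" by simp
    show "T *v (refl_prod t [v] *v (T *v x)) = refl_prod t [v] *v x"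
      unfolding H x T1 R1 by (simp add: algebra_simps)
  qed
  have d: "dim ?P = 3"
  proof -
    have "v \<noteq> a *\<^sub>R e" for a using Qv e'(1) by (auto simp: lor_Q_scale)
    then have "v \<notin> span {e}" by (auto simp: span_singleton)
    moreover have "lor_B t x e = 0" if "x \<in> span {v, e}" for x
      using that Bve Bee unfolding span_pair by auto
    then have "z \<notin> span {v, e}" using Bze Qv by fastforce
    ultimately have "dim {z, v, e} = 3" using e'(3) by (simp only: dim_insert dim_singleton) simp
    moreover have "{z, v, e} = {e, v, z}" by auto
    ultimately show ?thesis by simp
  qed
  have sp: "set [v] \<subseteq> ?P" "\<forall>u\<in>set [v]. lor_Q t u > 0" using Qv by (auto simp: span_base)
  obtain us where "\<forall>u\<in>set us. lor_Q t u > 0" "T ** refl_prod t us ** T = refl_prod t us"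
    "\<not> has_space_like_unit_eigenvector t T \<longrightarrow> 2 * length us + dim ?P = CARD('n) + 2 * length [v]"
    by (rule reverses_extend[OF T subspace_span TP p s sp rev])
  then show thesis using that d by auto
qed

subsection \<open>The three types of isometries\<close>

text \<open>The upper sheet is a graph over the hyperplane with time coordinate 0, hence connected,
  and it contains the base point of \<open>hyp_space\<close>.\<close>

lemma upper_sheet_hyp_space:
  fixes p :: "real^'n"
  assumes "lor_Q t p = -1" "p $ t > 0"
  shows "p \<in> hyp_space t"
proof -
  let ?f = "\<lambda>x::real^'n. x + sqrt (1 + x \<bullet> x) *\<^sub>R axis t 1"
  let ?S = "{x::real^'n. axis t 1 \<bullet> x = 0}"
  have Q: "lor_Q t (?f x) = -1" if "x \<in> ?S" for x
  proof -
    have x: "x $ t = 0" using that by (simp add: inner_axis')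
    have "lor_Q t (?f x) = lor_B t x x + (sqrt (1 + x \<bullet> x))\<^sup>2 * lor_B t (axis t 1) (axis t 1)"
      using x by (simp add: lor_B_axis lor_B_commute[of t "axis t 1" x] power2_eq_square flip: lor_B_self)
    also have "\<dots> = x \<bullet> x - (1 + x \<bullet> x)"
      by (simp add: lor_B_self lor_Q_axis_time lor_Q_time_zero[OF x])
    finally show ?thesis by simp
  qed
  have "connected ?S" by (intro convex_connected convex_hyperplane)
  then have "connected (?f ` ?S)"
    by (rule connected_continuous_image[rotated]) (intro continuous_intros)
  moreover have "?f ` ?S \<subseteq> {v. lor_Q t v = -1}" using Q by blast
  moreover have "axis t 1 \<in> ?f ` ?S" by (rule image_eqI[of _ _ 0]) auto
  moreover have "p \<in> ?f ` ?S"
  proof (rule image_eqI)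
    let ?x = "p - (p $ t) *\<^sub>R axis t 1"
    show "?x \<in> ?S" by (simp add: inner_axis' inner_diff_right)
    have "?x \<bullet> ?x = p \<bullet> p - (p $ t)\<^sup>2"
      by (simp add: inner_diff_left inner_diff_right inner_axis inner_axis' power2_eq_square algebra_simps)
    then have "1 + ?x \<bullet> ?x = (p $ t)\<^sup>2" using assms(1) by (simp add: lor_Q_eq)
    then have "sqrt (1 + ?x \<bullet> ?x) = p $ t" using assms(2) by simp
    then show "p = ?f ?x" by simp
  qed
  ultimately show ?thesis unfolding hyp_space_def
    using connected_component_maximal[of "axis t 1" "?f ` ?S"] by blast
qed

lemma hyp_space_time_like: "p \<in> hyp_space t \<Longrightarrow> lor_Q t p = -1"
  unfolding hyp_space_def using connected_component_subset by blast

lemma elliptic_axis_not_hyperbolic: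
  assumes "elliptic_axis t T p"
  shows "\<not> hyperbolic t T"
proof -
  let ?p = "(1 / sqrt (- lor_Q t p)) *\<^sub>R p"
  have p: "lor_Q t p < 0" "p $ t > 0" "T *v p = p" using assms by (auto simp: elliptic_axis_def)
  then have "?p \<in> hyp_space t"
    by (intro upper_sheet_hyp_space) (simp_all add: lor_Q_scale power_divide)
  moreover have "T *v ?p = ?p" using p by (simp add: matrix_vector_mult_scaleR)
  ultimately show ?thesis by (auto simp: hyperbolic_def elliptic_def)
qed

lemma image_span_singleton:
  fixes T :: "real^'n^'n"
  shows "(*v) T ` span {v} = span {T *v v}"
  by (auto simp: span_singleton matrix_vector_mult_scaleR image_image)

lemma span_scaleR_singleton:
  fixes v :: "'a::real_vector"
  assumes "c \<noteq> 0"
  shows "span {c *\<^sub>R v} = span {v}"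
proof
  show "span {c *\<^sub>R v} \<subseteq> span {v}" by (intro span_minimal) (auto intro: span_scale span_base)
  have "(1/c) *\<^sub>R (c *\<^sub>R v) \<in> span {c *\<^sub>R v}" by (intro span_scale span_base) simp
  then show "span {v} \<subseteq> span {c *\<^sub>R v}" using assms by (intro span_minimal) auto
qed

text \<open>The definition of hyperbolic is by exclusion. A fixed time-like vector would be
  orthogonal to the light-like e, which is impossible, and the two invariant lines of e and f
  contradict a unique boundary fixed point.\<close>

lemma boost_axis_hyperbolic:
  assumes T: "T \<in> O_n1 t" and e: "boost_axis t T r e"
  shows "hyperbolic t T"
proof -
  have e': "lor_Q t e = 0" "r > 0" "r \<noteq> 1" "T *v e = r *\<^sub>R e" "e \<noteq> 0"
    using e by (auto simp: boost_axis_def)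
  obtain f where f: "f \<noteq> 0" "T *v f = (1 / r) *\<^sub>R f" "lor_Q t f = 0" "lor_B t f e \<noteq> 0"
    using boost_axis_second[OF T e] .
  have "T \<noteq> mat 1"
  proof
    assume "T = mat 1"
    then have "(r - 1) *\<^sub>R e = 0" using e'(4) by (simp add: scaleR_diff_left)
    then show False using e'(3,5) by simp
  qed
  moreover have "\<not> (\<exists>p\<in>hyp_space t. T *v p = p)"
  proof
    assume "\<exists>p\<in>hyp_space t. T *v p = p"
    then obtain p where p: "lor_Q t p = -1" "T *v p = p" using hyp_space_time_like by blast
    then have "lor_B t p e = 0" using boost_axis_orth[OF T e, of p 1] e'(3) by simp
    then show False using orth_time_like[of t p e] p e' by (simp add: lor_B_commute[of t e])
  qed
  moreover have "\<not> (\<exists>!L. L \<in> ideal_boundary t \<and> (\<lambda>x. T *v x) ` L = L)"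
  proof
    assume "\<exists>!L. L \<in> ideal_boundary t \<and> (\<lambda>x. T *v x) ` L = L"
    moreover have "span {e} \<in> ideal_boundary t" "span {f} \<in> ideal_boundary t"
      using e' f by (auto simp: ideal_boundary_def light_like_def)
    moreover have "(*v) T ` span {e} = span {e}" "(*v) T ` span {f} = span {f}"
      unfolding image_span_singleton e'(4) f(2) using e'(2) by (intro span_scaleR_singleton; simp)+
    ultimately have "span {e} = span {f}" by blast
    then have "f \<in> span {e}" by (simp add: span_base)
    then show False using f(4) e'(1) by (auto simp: span_singleton lor_B_self)
  qed
  ultimately show ?thesis by (simp add: hyperbolic_def elliptic_def parabolic_def)
qed

text \<open>Any invariant light-like line is orthogonal to e, and orthogonal light-like vectors are
  parallel; so the boundary fixed point is unique.\<close>

lemma parabolic_axis_not_hyperbolic: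
  assumes T: "T \<in> O_n1 t" and e: "parabolic_axis t T e"
  shows "\<not> hyperbolic t T"
proof -
  have e': "lor_Q t e = 0" "T *v e = e" "e \<noteq> 0"
    using e by (auto simp: parabolic_axis_def)
  have no: "T *v p \<noteq> p" if "lor_Q t p < 0" for p
    using e that by (auto simp: parabolic_axis_def)
  have "T \<noteq> mat 1" using no[of "axis t 1"] by (auto simp: lor_Q_axis_time)
  moreover have "\<not> (\<exists>p\<in>hyp_space t. T *v p = p)"
    using no hyp_space_time_like[of _ t] by force
  moreover have "\<exists>!L. L \<in> ideal_boundary t \<and> (\<lambda>x. T *v x) ` L = L"
  proof (rule ex1I[of _ "span {e}"])
    show "span {e} \<in> ideal_boundary t \<and> (*v) T ` span {e} = span {e}"
      using e' by (auto simp: ideal_boundary_def light_like_def image_span_singleton)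
    fix L assume "L \<in> ideal_boundary t \<and> (*v) T ` L = L"
    then obtain v where v: "v \<noteq> 0" "lor_Q t v = 0" "L = span {v}" "span {T *v v} = span {v}"
      by (auto simp: ideal_boundary_def light_like_def image_span_singleton)
    have "T *v v \<in> span {v}" unfolding v(4)[symmetric] by (simp add: span_base)
    then obtain c where c: "T *v v = c *\<^sub>R v" by (auto simp: span_singleton)
    have "lor_B t v e = 0"
    proof (cases "c = 1")
      case True
      then show ?thesis using parabolic_axis_fixed[OF e, of v] c by simp
    next
      case False
      have "lor_B t (c *\<^sub>R v) e = lor_B t v e" using O_B[OF T, of v e] unfolding c e'(2) .
      then have "(c - 1) * lor_B t v e = 0" by (simp only: lor_B_simps) (simp add: left_diff_distrib)
      then show ?thesis using False by simp
    qed
    then obtain a where a: "v = a *\<^sub>R e" using orth_light_like(2)[OF e'(1,3) _ v(2)] by blast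
    then have "a \<noteq> 0" using v(1) by auto
    then show "L = span {e}" unfolding v(3) a by (rule span_scaleR_singleton)
  qed
  ultimately show ?thesis by (simp add: hyperbolic_def parabolic_def)
qed

section \<open>Isometries commuting with T preserve its axis\<close>

lemma elliptic_axis_preserved:
  assumes T: "T \<in> O_n1 t" and p: "elliptic_axis t T p" and no: "\<not> has_space_like_unit_eigenvector t T"
    and g: "g \<in> O_n1 t" "g ** T = T ** g"
  shows "\<exists>a. g *v p = a *\<^sub>R p"
proof -
  have p': "lor_Q t p < 0" "T *v p = p" using p by (auto simp: elliptic_axis_def)
  define a where "a = lor_B t (g *v p) p / lor_Q t p"
  define x where "x = g *v p - a *\<^sub>R p"
  have "T *v (g *v p) = g *v (T *v p)" by (simp add: matrix_vector_mul_assoc g(2))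
  then have "T *v x = x"
    by (simp add: x_def matrix_vector_mult_diff_distrib matrix_vector_mult_scaleR p'(2))
  moreover have "lor_B t x p = 0" using p'(1) by (simp add: x_def a_def lor_B_self)
  \<comment> \<open>A nonzero x would be a fixed vector orthogonal to the time-like p, that is, an
    excluded space-like eigenvector.\<close>
  ultimately have "x = 0"
    using no orth_time_like[OF p'(1), of x] unfolding has_space_like_unit_eigenvector_def by blast
  then show ?thesis by (auto simp: x_def)
qed

text \<open>Eigenvectors for r are orthogonal to e because r^2 is not 1. Since g e is also
  light-like, it must be parallel to e.\<close>

lemma boost_axis_preserved:
  assumes T: "T \<in> O_n1 t" and e: "boost_axis t T r e" and g: "g \<in> O_n1 t" "g ** T = T ** g"
  shows "\<exists>a. g *v e = a *\<^sub>R e"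
proof -
  have e': "lor_Q t e = 0" "r > 0" "r \<noteq> 1" "T *v e = r *\<^sub>R e" "e \<noteq> 0"
    using e by (auto simp: boost_axis_def)
  have "T *v (g *v e) = g *v (T *v e)" by (simp add: matrix_vector_mul_assoc g(2))
  then have "T *v (g *v e) = r *\<^sub>R (g *v e)" by (simp add: e'(4) matrix_vector_mult_scaleR)
  moreover have "r * r \<noteq> 1" using e'(2,3) by (simp add: power2_eq_1_iff flip: power2_eq_square)
  ultimately have "lor_B t (g *v e) e = 0" by (rule boost_axis_orth[OF T e])
  then show ?thesis using orth_light_like(2)[OF e'(1,5), of "g *v e"] O_Q[OF g(1), of e] e'(1) by auto
qed

lemma parabolic_axis_preserved:
  assumes e: "parabolic_axis t T e" and g: "g \<in> O_n1 t" "g ** T = T ** g"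
  shows "\<exists>a. g *v e = a *\<^sub>R e"
proof -
  have e': "lor_Q t e = 0" "T *v e = e" "e \<noteq> 0" using e by (auto simp: parabolic_axis_def)
  have "T *v (g *v e) = g *v (T *v e)" by (simp add: matrix_vector_mul_assoc g(2))
  then have "lor_B t (g *v e) e = 0" using parabolic_axis_fixed[OF e] e'(2) by simp
  then show ?thesis using orth_light_like(2)[OF e'(1,3), of "g *v e"] O_Q[OF g(1), of e] e'(1) by auto
qed

subsection \<open>Criterion for reality\<close>

lemma hyperbolic_boost_axis:
  assumes "T \<in> SOo_n1 t" "hyperbolic t T"
  obtains r e where "boost_axis t T r e"
  using axis_cases[OF SOo_O[OF assms(1)] SOo_orthochronous[OF assms(1)]]
    elliptic_axis_not_hyperbolic parabolic_axis_not_hyperbolic[OF SOo_O[OF assms(1)]] assms(2) that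
  by blast

text \<open>The causal eigenvector with positive eigenvalue is orthogonal to every eigenvector for
  -1. This is why the theorem can speak of the eigenvalue -1 without asking for a space-like
  eigenvector.\<close>

lemma minus_one_eigenvector_space_like:
  assumes T: "T \<in> SOo_n1 t" and v: "T *v v = - v" "v \<noteq> 0"
  shows "lor_Q t v > 0"
proof -
  obtain e r where e: "lor_Q t e \<le> 0" "e $ t > 0" "r > 0" "T *v e = r *\<^sub>R e"
    using causal_eigenvector[OF SOo_O[OF T] SOo_orthochronous[OF T]] .
  have "lor_B t (- v) (r *\<^sub>R e) = lor_B t v e" using O_B[OF SOo_O[OF T], of v e] unfolding v(1) e(4) .
  then have "(1 + r) * lor_B t v e = 0" by (simp only: lor_B_simps) (simp add: distrib_right)
  then have B: "lor_B t v e = 0" using e(3) by simp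
  have "v \<noteq> a *\<^sub>R e" for a
  proof
    assume a: "v = a *\<^sub>R e"
    have "a *\<^sub>R (r *\<^sub>R e) = - (a *\<^sub>R e)" using v(1) unfolding a matrix_vector_mult_scaleR e(4) .
    then have "(a * (r + 1)) *\<^sub>R e = 0" by (simp add: distrib_left scaleR_add_left)
    then show False using e(3) a v(2) by auto
  qed
  moreover have "e \<noteq> 0" using e(2) by auto
  ultimately show ?thesis using orth_causal[OF e(1) _ B] by blast
qed

text \<open>The eigenvalue r of the boost axis differs from 1, so fixed vectors are orthogonal to
  that axis. This justifies the bare eigenvalue condition in part 2 of the theorem.\<close>

lemma hyperbolic_fixed_space_like:
  assumes T: "T \<in> SOo_n1 t" and h: "hyperbolic t T" and v: "T *v v = v" "v \<noteq> 0"
  shows "lor_Q t v > 0"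
proof -
  obtain r e where b: "boost_axis t T r e" using hyperbolic_boost_axis[OF T h] .
  then have e: "lor_Q t e \<le> 0" "e \<noteq> 0" "r \<noteq> 1" "T *v e = r *\<^sub>R e" by (auto simp: boost_axis_def)
  have B: "lor_B t v e = 0" using boost_axis_orth[OF SOo_O[OF T] b, of v 1] v e(3) by simp
  have "v \<noteq> a *\<^sub>R e" for a
  proof
    assume a: "v = a *\<^sub>R e"
    have "a *\<^sub>R (r *\<^sub>R e) = a *\<^sub>R e" using v(1) unfolding a matrix_vector_mult_scaleR e(4) .
    then have "(a * (r - 1)) *\<^sub>R e = 0" by (simp add: right_diff_distrib scaleR_diff_left)
    then show False using e(3) a v(2) by auto
  qed
  then show ?thesis using orth_causal[OF e(1,2) B] by blast
qed

lemma hyperbolic_unit_eigenvalue_iff: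
  assumes "T \<in> SOo_n1 t" "hyperbolic t T"
  shows "has_space_like_unit_eigenvector t T \<longleftrightarrow> has_eigenvalue T 1 \<or> has_eigenvalue T (-1)"
proof -
  have "v \<noteq> 0" if "lor_Q t v > 0" for v using that by (auto simp: lor_Q_eq)
  then show ?thesis
    using minus_one_eigenvector_space_like[OF assms(1)] hyperbolic_fixed_space_like[OF assms]
    by (auto simp: has_space_like_unit_eigenvector_def has_eigenvalue_def) blast+
qed

lemma space_like_unit_eigenvector_iff:
  assumes "T \<in> SOo_n1 t"
  shows "has_space_like_unit_eigenvector t T \<longleftrightarrow>
    has_eigenvalue T (-1) \<or> (\<exists>v. v \<noteq> 0 \<and> T *v v = v \<and> space_like t v)"
proof -
  have "v \<noteq> 0" if "lor_Q t v > 0" for v using that by (auto simp: lor_Q_eq)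
  then show ?thesis
    using minus_one_eigenvector_space_like[OF assms]
    by (auto simp: has_space_like_unit_eigenvector_def has_eigenvalue_def space_like_def)
qed

lemma real_if_space_like_unit_eigenvector:
  assumes T: "T \<in> SOo_n1 t" and has: "has_space_like_unit_eigenvector t T"
  shows "real_in_SOo t T"
proof -
  note TO = SOo_O[OF T]
  obtain us where us: "\<forall>u\<in>set us. lor_Q t u > 0" "T ** refl_prod t us ** T = refl_prod t us"
    using axis_cases[OF TO SOo_orthochronous[OF T]] elliptic_axis_reverses[OF TO]
      boost_axis_reverses[OF TO] parabolic_axis_reverses[OF TO] by metis
  then show ?thesis using real_of_space_like_unit_eigenvector[OF T _ _ has] by blast
qed

lemma real_iff_even_reflections:
  assumes "T \<in> SOo_n1 t" "\<forall>u\<in>set us. lor_Q t u > 0" "T ** refl_prod t us ** T = refl_prod t us"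
    "\<not> has_space_like_unit_eigenvector t T" "lor_Q t e \<le> 0" "e $ t > 0"
    "\<And>g. g \<in> O_n1 t \<Longrightarrow> g ** T = T ** g \<Longrightarrow> \<exists>a. g *v e = a *\<^sub>R e"
  shows "real_in_SOo t T \<longleftrightarrow> even (length us)"
proof
  show "real_in_SOo t T" if "even (length us)"
    unfolding real_in_SOo_iff[OF assms(1)] using refl_prod_SOo[OF assms(2) that] assms(3) by blast
  show "even (length us)" if "real_in_SOo t T"
    using not_real_of_odd[OF assms(1-3) _ assms(4-6)] assms(7) that by blast
qed

text \<open>The number k counts the reflections. Its existence also shows that n is odd here: for
  even n, a hyperbolic T always has an eigenvector that makes it real.\<close>

lemma real_iff_hyperbolic:
  fixes T :: "real^'n^'n"
  assumes T: "T \<in> SOo_n1 t" and no: "\<not> has_space_like_unit_eigenvector t T" and h: "hyperbolic t T"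
  obtains k where "2 * k = CARD('n)" "real_in_SOo t T \<longleftrightarrow> even k"
proof -
  note TO = SOo_O[OF T]
  obtain r e where e: "boost_axis t T r e" using hyperbolic_boost_axis[OF T h] .
  obtain us where us: "\<forall>u\<in>set us. lor_Q t u > 0" "T ** refl_prod t us ** T = refl_prod t us"
    "\<not> has_space_like_unit_eigenvector t T \<longrightarrow> 2 * length us = CARD('n)"
    by (rule boost_axis_reverses[OF TO e])
  have "real_in_SOo t T \<longleftrightarrow> even (length us)"
    by (rule real_iff_even_reflections[OF T us(1,2) no _ _ boost_axis_preserved[OF TO e]])
      (use e in \<open>auto simp: boost_axis_def\<close>)
  then show thesis using us(3) no that by blast
qed

lemma real_iff_not_hyperbolic:
  fixes T :: "real^'n^'n"
  assumes T: "T \<in> SOo_n1 t" and no: "\<not> has_space_like_unit_eigenvector t T" and h: "\<not> hyperbolic t T"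
  obtains k where "2 * k + 1 = CARD('n)" "real_in_SOo t T \<longleftrightarrow> even k"
proof -
  note TO = SOo_O[OF T]
  show thesis
  proof (rule axis_cases[OF TO SOo_orthochronous[OF T]])
    fix p assume p: "elliptic_axis t T p"
    obtain us where us: "\<forall>u\<in>set us. lor_Q t u > 0" "T ** refl_prod t us ** T = refl_prod t us"
      "\<not> has_space_like_unit_eigenvector t T \<longrightarrow> 2 * length us + 1 = CARD('n)"
      by (rule elliptic_axis_reverses[OF TO p])
    have "real_in_SOo t T \<longleftrightarrow> even (length us)"
      by (rule real_iff_even_reflections[OF T us(1,2) no _ _ elliptic_axis_preserved[OF TO p no]])
        (use p in \<open>auto simp: elliptic_axis_def\<close>)
    then show thesis using us(3) no that by blast
  next
    fix r e assume "boost_axis t T r e"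
    then show thesis using boost_axis_hyperbolic[OF TO] h by blast
  next
    fix e assume e: "parabolic_axis t T e"
    obtain us where us: "\<forall>u\<in>set us. lor_Q t u > 0" "T ** refl_prod t us ** T = refl_prod t us"
      "\<not> has_space_like_unit_eigenvector t T \<longrightarrow> 2 * length us + 1 = CARD('n)"
      by (rule parabolic_axis_reverses[OF TO e])
    have "real_in_SOo t T \<longleftrightarrow> even (length us)"
      by (rule real_iff_even_reflections[OF T us(1,2) no _ _ parabolic_axis_preserved[OF e]])
        (use e in \<open>auto simp: parabolic_axis_def\<close>)
    then show thesis using us(3) no that by blast
  qed
qed

subsection \<open>Elements that are not real\<close>

lemma axis_nth: "axis i (1::real) $ j = (if j = i then 1 else 0)"
  by (simp add: axis_def)

lemma eq_minus_self_vector: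
  fixes y :: "'a::real_vector"
  assumes "y = - y"
  shows "y = 0"
proof -
  have "2 *\<^sub>R y = 0" unfolding scaleR_2 using assms by (simp only: eq_neg_iff_add_eq_0)
  then show ?thesis by simp
qed

text \<open>The product of reflections in axes at an angle of 45 degrees turns the (i, j) plane by
  90 degrees. Writing it with two space-like reflections puts it in the identity component without
  exhibiting a path.\<close>

lemma quarter_turn:
  fixes t i j :: "'n::finite"
  assumes "i \<noteq> t" "j \<noteq> t" "i \<noteq> j"
  obtains R where "R \<in> SOo_n1 t"
    "\<forall>x. R *v x = x - (x $ i) *\<^sub>R axis i 1 + (x $ j) *\<^sub>R axis i 1
      - (x $ i) *\<^sub>R axis j 1 - (x $ j) *\<^sub>R axis j 1"
proof -
  let ?u = "axis i 1 - axis j 1 :: real^'n"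
  have Q: "lor_Q t (axis i 1) = 1" using assms(1) by (rule lor_Q_axis_space)
  have Bi: "lor_B t x (axis i 1) = x $ i" and Bj: "lor_B t x (axis j 1) = x $ j" for x
    using assms(1,2) by (simp_all add: lor_B_def inner_axis axis_nth)
  have Qu: "lor_Q t ?u = 2" using assms(3) by (simp add: Bi Bj axis_nth flip: lor_B_self)
  have "(lor_refl t ?u ** lor_refl t (axis i 1)) *v x = x - (x $ i) *\<^sub>R axis i 1 + (x $ j) *\<^sub>R axis i 1
      - (x $ i) *\<^sub>R axis j 1 - (x $ j) *\<^sub>R axis j 1" for x
    using assms(3)
    by (simp add: lor_refl_mult Q Qu Bi Bj axis_nth vec_eq_iff algebra_simps flip: matrix_vector_mul_assoc)
      (auto simp: field_simps)
  moreover have "lor_refl t ?u ** lor_refl t (axis i 1) \<in> SOo_n1 t"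
    by (rule lor_refl_pair_SOo) (simp_all add: Q Qu)
  ultimately show thesis using that by blast
qed

text \<open>Quarter turns in disjoint pairs of space-like coordinates make T^2 = -1 on the
  coordinates in S, which leaves no real eigenvalue there.\<close>

lemma complex_structure_exists:
  fixes t :: "'n::finite"
  assumes "finite S" "even (card S)" "t \<notin> S"
  shows "\<exists>T\<in>SOo_n1 t. (\<forall>x. (\<forall>i. i \<notin> S \<longrightarrow> x $ i = 0) \<longrightarrow>
      T *v (T *v x) = - x \<and> (\<forall>i. i \<notin> S \<longrightarrow> (T *v x) $ i = 0)) \<and>
    (\<forall>x. (\<forall>i\<in>S. x $ i = 0) \<longrightarrow> T *v x = x)"
  using assms
proof (induction "card S" arbitrary: S rule: less_induct)
  case less
  show ?case
  proof (cases "S = {}")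
    case True
    have "x = 0" if "\<forall>i. x $ i = 0" for x :: "real^'n" using that by (simp add: vec_eq_iff)
    then show ?thesis using True SOo_one[of t] by (intro bexI[of _ "mat 1"]) auto
  next
    case False
    then obtain i where i: "i \<in> S" by blast
    have c2: "card (S - {i}) = card S - 1" "card S > 0" 
      using i less.prems(1) by (auto simp: card_gt_0_iff)
    have "S - {i} \<noteq> {}"
    proof
      assume "S - {i} = {}"
      then have "card S - 1 = 0" using c2(1) by (metis card.empty)
      then show False using c2(2) less.prems(2) by (cases "card S = 1") auto
    qed
    then obtain j where j: "j \<in> S" "j \<noteq> i" by blast
    let ?S = "S - {i, j}"
    have cS: "card S = card ?S + 2"
      using i j less.prems(1) card_Diff_subset[of "{i, j}" S] card_mono[of S "{i, j}"] by simp
    have "even (card ?S)" using cS less.prems(2) by simp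
    then obtain T where T: "T \<in> SOo_n1 t"
      "\<And>x. (\<forall>k. k \<notin> ?S \<longrightarrow> x $ k = 0) \<Longrightarrow> T *v (T *v x) = - x \<and> (\<forall>k. k \<notin> ?S \<longrightarrow> (T *v x) $ k = 0)"
      "\<And>x. (\<forall>k\<in>?S. x $ k = 0) \<Longrightarrow> T *v x = x"
      using less.hyps[of ?S] cS less.prems(1,3) by auto
    have ij: "i \<noteq> t" "j \<noteq> t" "i \<noteq> j" using i j less.prems(3) by auto
    obtain R where R: "R \<in> SOo_n1 t"
      "\<forall>x. R *v x = x - (x $ i) *\<^sub>R axis i 1 + (x $ j) *\<^sub>R axis i 1
        - (x $ i) *\<^sub>R axis j 1 - (x $ j) *\<^sub>R axis j 1"
      using quarter_turn[OF ij] .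
    have RT: "(R ** T) *v (y + a *\<^sub>R axis i 1 + b *\<^sub>R axis j 1) = T *v y + b *\<^sub>R axis i 1 + (- a) *\<^sub>R axis j 1"
      if y: "\<forall>k. k \<notin> ?S \<longrightarrow> y $ k = 0" for y a b
    proof -
      have Ta: "T *v axis i 1 = axis i 1" "T *v axis j 1 = axis j 1"
        by (rule T(3), simp add: axis_nth)+
      have Ty: "(T *v y) $ i = 0" "(T *v y) $ j = 0" using T(2)[OF y] by auto
      have "(R ** T) *v (y + a *\<^sub>R axis i 1 + b *\<^sub>R axis j 1) = R *v (T *v y + a *\<^sub>R axis i 1 + b *\<^sub>R axis j 1)"
        by (simp add: matrix_vector_right_distrib matrix_vector_mult_scaleR Ta flip: matrix_vector_mul_assoc)
      also have "\<dots> = T *v y + b *\<^sub>R axis i 1 + (- a) *\<^sub>R axis j 1"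
        unfolding R(2)[rule_format] using ij(3) Ty by (simp add: axis_nth algebra_simps)
      finally show ?thesis .
    qed
    have 1: "(R ** T) *v ((R ** T) *v x) = - x \<and> (\<forall>k. k \<notin> S \<longrightarrow> ((R ** T) *v x) $ k = 0)"
      if x: "\<forall>k. k \<notin> S \<longrightarrow> x $ k = 0" for x
    proof -
      define y where "y = x - (x $ i) *\<^sub>R axis i 1 - (x $ j) *\<^sub>R axis j 1"
      have y: "\<forall>k. k \<notin> ?S \<longrightarrow> y $ k = 0" using x ij(3) by (auto simp: y_def axis_nth)
      have xy: "x = y + (x $ i) *\<^sub>R axis i 1 + (x $ j) *\<^sub>R axis j 1" by (simp add: y_def)
      have r1: "(R ** T) *v x = T *v y + (x $ j) *\<^sub>R axis i 1 + (- (x $ i)) *\<^sub>R axis j 1"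
        by (subst xy) (rule RT[OF y])
      have "(R ** T) *v ((R ** T) *v x) = T *v (T *v y) + (- (x $ i)) *\<^sub>R axis i 1 + (- (x $ j)) *\<^sub>R axis j 1"
        unfolding r1 by (rule RT) (use T(2)[OF y] in blast)
      also have "\<dots> = - x" using T(2)[OF y] by (simp add: y_def)
      finally have "(R ** T) *v ((R ** T) *v x) = - x" .
      moreover have "((R ** T) *v x) $ k = 0" if "k \<notin> S" for k
      proof -
        have "k \<noteq> i" "k \<noteq> j" "k \<notin> ?S" using that i j by auto
        then show ?thesis unfolding r1 using T(2)[OF y] by (simp add: axis_nth)
      qed
      ultimately show ?thesis by blast
    qed
    have 2: "(R ** T) *v x = x" if x: "\<forall>k\<in>S. x $ k = 0" for x
    proof -
      have "T *v x = x" using x by (intro T(3)) auto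
      moreover have "R *v x = x" unfolding R(2)[rule_format] using x i j by simp
      ultimately show ?thesis by (simp flip: matrix_vector_mul_assoc)
    qed
    show ?thesis using SOo_mult[OF R(1) T(1)] 1 2 by blast
  qed
qed

lemma elliptic_example:
  fixes t :: "'n::finite"
  assumes "odd CARD('n)"
  obtains T where "T \<in> SOo_n1 t" "\<not> hyperbolic t T" "\<not> has_space_like_unit_eigenvector t T"
proof -
  have "even (card (UNIV - {t}))" using assms by (simp add: card_Diff_singleton)
  then obtain T where T: "T \<in> SOo_n1 t"
    "\<And>x. (\<forall>i. i \<notin> UNIV - {t} \<longrightarrow> x $ i = 0) \<Longrightarrow>
      T *v (T *v x) = - x \<and> (\<forall>i. i \<notin> UNIV - {t} \<longrightarrow> (T *v x) $ i = 0)"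
    "\<And>x. (\<forall>i\<in>UNIV - {t}. x $ i = 0) \<Longrightarrow> T *v x = x"
    using complex_structure_exists[of "UNIV - {t}" t] by auto
  have Tt: "T *v axis t 1 = axis t 1" by (rule T(3)) (simp add: axis_nth)
  have "elliptic_axis t T (axis t 1)"
    using Tt by (simp add: elliptic_axis_def lor_Q_axis_time)
  then have "\<not> hyperbolic t T" by (rule elliptic_axis_not_hyperbolic)
  moreover have "\<not> has_space_like_unit_eigenvector t T"
    unfolding has_space_like_unit_eigenvector_def
  proof
    assume "\<exists>v. lor_Q t v > 0 \<and> (T *v v = v \<or> T *v v = - v)"
    then obtain v where v: "lor_Q t v > 0" "T *v v = v \<or> T *v v = - v" by blast
    \<comment> \<open>Squaring treats both eigenvalues at once. The space part of v is then both
      fixed and negated by T^2, so v lies on the time axis and is not space-like.\<close>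
    then have TTv: "T *v (T *v v) = v" by (auto simp: linear_neg[OF matrix_vector_mul_linear])
    define y where "y = v - (v $ t) *\<^sub>R axis t 1"
    have "T *v (T *v y) = y" by (simp add: y_def matrix_vector_mult_diff_distrib matrix_vector_mult_scaleR Tt TTv)
    moreover have "T *v (T *v y) = - y" using T(2)[of y] by (simp add: y_def axis_nth)
    ultimately have "y = 0" by (metis eq_minus_self_vector)
    then have "v = (v $ t) *\<^sub>R axis t 1" by (simp add: y_def)
    then have "lor_Q t v = (v $ t)\<^sup>2 * lor_Q t (axis t 1)" by (metis lor_Q_scale)
    then show False using v(1) by (simp add: lor_Q_axis_time not_less)
  qed
  ultimately show thesis using that T(1) by blast
qed

lemma hyperbolic_example:
  fixes t :: "'n::finite"
  assumes "even CARD('n)"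
  obtains T where "T \<in> SOo_n1 t" "hyperbolic t T" "\<not> has_space_like_unit_eigenvector t T"
proof -
  have "card (UNIV - {t}) = CARD('n) - 1" "CARD('n) > 0" by (simp_all add: card_Diff_singleton card_gt_0_iff)
  moreover have "CARD('n) \<noteq> 1" using assms by auto
  ultimately have "card (UNIV - {t}) \<noteq> 0" by linarith
  then obtain a where a: "a \<noteq> t" by (metis DiffE card.empty ex_in_conv singletonI)
  let ?S = "UNIV - {a, t}"
  have "card ?S = CARD('n) - 2" using a by (simp add: card_Diff_subset)
  then have "even (card ?S)" using assms by simp
  then obtain A where A: "A \<in> SOo_n1 t"
    "\<And>x. (\<forall>i. i \<notin> ?S \<longrightarrow> x $ i = 0) \<Longrightarrow> A *v (A *v x) = - x \<and> (\<forall>i. i \<notin> ?S \<longrightarrow> (A *v x) $ i = 0)"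
    "\<And>x. (\<forall>i\<in>?S. x $ i = 0) \<Longrightarrow> A *v x = x"
    using complex_structure_exists[of ?S t] by auto
  \<comment> \<open>Reflecting in axis a and then in axis a + s axis t is a boost with factor
    (1+s)/(1-s) whenever 0 < s < 1; s = 1/2 gives the factor 3.\<close>
  let ?w = "axis a 1 + (1/2) *\<^sub>R axis t 1 :: real^'n"
  define C where "C = lor_refl t ?w ** lor_refl t (axis a 1)"
  have Q: "lor_Q t (axis a 1) = 1" using a by (rule lor_Q_axis_space)
  have Ba: "lor_B t x (axis a 1) = x $ a" for x using a by (simp add: lor_B_def inner_axis axis_nth)
  have Qw: "lor_Q t ?w = 3/4" using a by (simp add: Ba lor_B_axis axis_nth flip: lor_B_self)
  have C: "C \<in> SOo_n1 t" unfolding C_def by (rule lor_refl_pair_SOo) (simp_all add: Q Qw)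
  let ?e = "axis t 1 + axis a 1 :: real^'n" and ?f = "axis t 1 - axis a 1 :: real^'n"
  have Ce: "C *v ?e = 3 *\<^sub>R ?e" and Cf: "C *v ?f = (1/3) *\<^sub>R ?f"
    unfolding C_def using a
    by (simp_all add: lor_refl_mult Q Qw Ba lor_B_axis axis_nth vec_eq_iff flip: matrix_vector_mul_assoc)
  have Cy: "C *v y = y" if "y $ a = 0" "y $ t = 0" for y
    unfolding C_def using that
    by (simp add: lor_refl_mult Ba lor_B_axis flip: matrix_vector_mul_assoc)
  have Ae: "A *v ?e = ?e" and Af: "A *v ?f = ?f" by (rule A(3), simp add: axis_nth)+
  define T where "T = A ** C"
  have T: "T \<in> SOo_n1 t" unfolding T_def using A(1) C by (rule SOo_mult)
  note lin = matrix_vector_right_distrib matrix_vector_mult_scaleR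
  have Te: "T *v ?e = 3 *\<^sub>R ?e" and Tf: "T *v ?f = (1/3) *\<^sub>R ?f"
    unfolding T_def matrix_vector_mul_assoc[symmetric] Ce Cf matrix_vector_mult_scaleR Ae Af by simp_all
  have "boost_axis t T 3 ?e"
    using Te a by (simp add: boost_axis_def Ba lor_B_axis axis_nth flip: lor_B_self)
  then have h: "hyperbolic t T" by (rule boost_axis_hyperbolic[OF SOo_O[OF T]])
  have "\<not> has_space_like_unit_eigenvector t T"
    unfolding has_space_like_unit_eigenvector_def
  proof
    assume "\<exists>v. lor_Q t v > 0 \<and> (T *v v = v \<or> T *v v = - v)"
    then obtain v where v: "lor_Q t v > 0" "T *v v = v \<or> T *v v = - v" by blast
    then have TTv: "T *v (T *v v) = v" by (auto simp: linear_neg[OF matrix_vector_mul_linear])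
    \<comment> \<open>These are the coordinates of v along the two light-like eigenvectors of the
      boost. T^2 multiplies them by 9 and 1/9 and negates the rest y, so a vector fixed by T^2 is
      zero.\<close>
    define \<alpha> \<beta> where "\<alpha> = (v $ t + v $ a) / 2" and "\<beta> = (v $ t - v $ a) / 2"
    define y where "y = v - \<alpha> *\<^sub>R ?e - \<beta> *\<^sub>R ?f"
    have y: "y $ a = 0" "y $ t = 0" using a by (auto simp: y_def \<alpha>_def \<beta>_def axis_nth field_simps)
    have vy: "v = y + \<alpha> *\<^sub>R ?e + \<beta> *\<^sub>R ?f" by (simp only: y_def) simp
    have Ay: "A *v (A *v y) = - y" "(A *v y) $ a = 0" "(A *v y) $ t = 0"
      using A(2)[of y] y by auto
    have Ty: "T *v y = A *v y" by (simp add: T_def Cy[OF y] flip: matrix_vector_mul_assoc)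
    have TTy: "T *v (A *v y) = - y"
      using Cy[OF Ay(2,3)] Ay(1) by (simp add: T_def flip: matrix_vector_mul_assoc)
    have Tl: "T *v (u + p *\<^sub>R w + q *\<^sub>R z) = T *v u + p *\<^sub>R (T *v w) + q *\<^sub>R (T *v z)" for u w z p q
      by (simp add: lin)
    have "T *v (T *v v) = - y + \<alpha> *\<^sub>R 3 *\<^sub>R 3 *\<^sub>R ?e + \<beta> *\<^sub>R (1/3) *\<^sub>R (1/3) *\<^sub>R ?f"
      by (simp only: vy Tl Te Tf Ty TTy matrix_vector_mult_scaleR)
    then have "T *v (T *v v) = - y + (9 * \<alpha>) *\<^sub>R ?e + (\<beta> / 9) *\<^sub>R ?f"
      by (simp only: scaleR_scaleR) (simp add: mult.commute)
    then have eq: "- y + (9 * \<alpha>) *\<^sub>R ?e + (\<beta> / 9) *\<^sub>R ?f = y + \<alpha> *\<^sub>R ?e + \<beta> *\<^sub>R ?f"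
      using TTv vy by simp
    have "9 * \<alpha> + \<beta> / 9 = \<alpha> + \<beta>" "9 * \<alpha> - \<beta> / 9 = \<alpha> - \<beta>"
      using arg_cong[OF eq, of "\<lambda>x. x $ t"] arg_cong[OF eq, of "\<lambda>x. x $ a"] a y
      by (simp_all add: axis_nth)
    then have "\<alpha> = 0" "\<beta> = 0" by linarith+
    then have "y = - y" using eq by simp
    then have "y = 0" by (rule eq_minus_self_vector)
    then have "v = 0" using vy \<open>\<alpha> = 0\<close> \<open>\<beta> = 0\<close> by simp
    then show False using v(1) by (simp add: lor_Q_eq)
  qed
  then show thesis using that T h by blast
qed

theorem theorem1p1:
  fixes t :: "'n::finite"
  assumes "CARD('n) \<ge> 2"
  defines "n \<equiv> CARD('n) - 1"
  shows "((\<forall>T\<in>SOo_n1 t. real_in_SOo t T) \<longleftrightarrow> (n mod 4 = 0 \<or> n mod 4 = 3))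
    \<and> (n mod 4 = 1 \<longrightarrow> (\<forall>T\<in>SOo_n1 t. real_in_SOo t T \<longleftrightarrow>
          ((hyperbolic t T \<and> (has_eigenvalue T 1 \<or> has_eigenvalue T (-1))) \<or> \<not> hyperbolic t T)))
    \<and> (n mod 4 = 2 \<longrightarrow> (\<forall>T\<in>SOo_n1 t. real_in_SOo t T \<longleftrightarrow>
          (hyperbolic t T
           \<or> (\<not> hyperbolic t T \<and> has_eigenvalue T (-1))
           \<or> (\<not> hyperbolic t T \<and> \<not> has_eigenvalue T (-1)
              \<and> (\<exists>v. v \<noteq> 0 \<and> T *v v = v \<and> space_like t v)))))"
proof -
  have n: "CARD('n) = n + 1" using assms by simp
  \<comment> \<open>This fact and \<open>non\<close> determine reality in every dimension; the three
    parts of the theorem are read off from them by residue. Here 2k = n + 1, so k is odd exactly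
    when n = 1 mod 4.\<close>
  have hyp: "real_in_SOo t T \<longleftrightarrow> has_space_like_unit_eigenvector t T \<or> n mod 4 \<noteq> 1"
    if T: "T \<in> SOo_n1 t" and h: "hyperbolic t T" for T
  proof (cases "has_space_like_unit_eigenvector t T")
    case False
    obtain k where "2 * k = CARD('n)" "real_in_SOo t T \<longleftrightarrow> even k"
      using real_iff_hyperbolic[OF T False h] .
    moreover have "even k \<longleftrightarrow> n mod 4 \<noteq> 1" if "2 * k = n + 1" using that by presburger
    ultimately show ?thesis using False n by simp
  qed (use real_if_space_like_unit_eigenvector[OF T] in blast)
  have non: "real_in_SOo t T \<longleftrightarrow> has_space_like_unit_eigenvector t T \<or> n mod 4 \<noteq> 2"
    if T: "T \<in> SOo_n1 t" and h: "\<not> hyperbolic t T" for T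
  proof (cases "has_space_like_unit_eigenvector t T")
    case False
    obtain k where "2 * k + 1 = CARD('n)" "real_in_SOo t T \<longleftrightarrow> even k"
      using real_iff_not_hyperbolic[OF T False h] .
    moreover have "even k \<longleftrightarrow> n mod 4 \<noteq> 2" if "2 * k = n" using that by presburger
    ultimately show ?thesis using False n by simp
  qed (use real_if_space_like_unit_eigenvector[OF T] in blast)
  have n4: "n mod 4 = 0 \<or> n mod 4 = 1 \<or> n mod 4 = 2 \<or> n mod 4 = 3" by presburger
  \<comment> \<open>The criterion alone does not show that the bad case occurs; the explicit
    examples rule out the residues 1 and 2 in part 1.\<close>
  have ex1: "\<exists>T\<in>SOo_n1 t. \<not> real_in_SOo t T" if m: "n mod 4 = 1"
  proof -
    have "even CARD('n)" unfolding n using m by presburger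
    then obtain T where "T \<in> SOo_n1 t" "hyperbolic t T" "\<not> has_space_like_unit_eigenvector t T"
      using hyperbolic_example by blast
    then show ?thesis using hyp m by blast
  qed
  have ex2: "\<exists>T\<in>SOo_n1 t. \<not> real_in_SOo t T" if m: "n mod 4 = 2"
  proof -
    have "odd CARD('n)" unfolding n using m by presburger
    then obtain T where "T \<in> SOo_n1 t" "\<not> hyperbolic t T" "\<not> has_space_like_unit_eigenvector t T"
      using elliptic_example by blast
    then show ?thesis using non m by blast
  qed
  have all: "real_in_SOo t T" if "n mod 4 = 0 \<or> n mod 4 = 3" "T \<in> SOo_n1 t" for T
    using hyp[OF that(2)] non[OF that(2)] that(1) by (cases "hyperbolic t T") auto
  have case1: "real_in_SOo t T \<longleftrightarrow>
      (hyperbolic t T \<and> (has_eigenvalue T 1 \<or> has_eigenvalue T (-1))) \<or> \<not> hyperbolic t T"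
    if "n mod 4 = 1" "T \<in> SOo_n1 t" for T
    using hyp[OF that(2)] non[OF that(2)] that(1) hyperbolic_unit_eigenvalue_iff[OF that(2)]
    by (cases "hyperbolic t T") auto
  have case2: "real_in_SOo t T \<longleftrightarrow>
      (hyperbolic t T
       \<or> (\<not> hyperbolic t T \<and> has_eigenvalue T (-1))
       \<or> (\<not> hyperbolic t T \<and> \<not> has_eigenvalue T (-1)
          \<and> (\<exists>v. v \<noteq> 0 \<and> T *v v = v \<and> space_like t v)))"
    if "n mod 4 = 2" "T \<in> SOo_n1 t" for T
    using hyp[OF that(2)] non[OF that(2)] that(1) space_like_unit_eigenvector_iff[OF that(2)]
    by (cases "hyperbolic t T") auto
  show ?thesis
  proof (intro conjI impI ballI)
    show "(\<forall>T\<in>SOo_n1 t. real_in_SOo t T) \<longleftrightarrow> (n mod 4 = 0 \<or> n mod 4 = 3)"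
    proof
      assume a: "\<forall>T\<in>SOo_n1 t. real_in_SOo t T"
      have "n mod 4 \<noteq> 1" using ex1 a by blast
      moreover have "n mod 4 \<noteq> 2" using ex2 a by blast
      ultimately show "n mod 4 = 0 \<or> n mod 4 = 3" using n4 by blast
    next
      assume "n mod 4 = 0 \<or> n mod 4 = 3"
      then show "\<forall>T\<in>SOo_n1 t. real_in_SOo t T" by (intro ballI all)
    qed
  qed (rule case1 case2; assumption)+
qed

end
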